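(* Let $f$ be a capacity function. For every $x\in\mathbb{R}^2$, the average capacity per user is $$E\big(f(\xi_0^x)\big)=\lambda_B\int_0^\infty B'(\beta)e^{-\lambda_B B(\beta)}f(\beta)\,d\beta .$$ In the case of the path loss exponent model $L(z)=K|z|^{-\gamma}$, one has $$E\big(f(\xi_0^x)\big)=\mathcal{L}_{\widetilde f}(\lambda_B C),$$ where $C=\pi K^{2/\gamma}E(H^{2/\gamma})$, $\widetilde f(t)=f(t^{\gamma/2})$, and $\mathcal{L}_g(s)=\int_0^\infty e^{-st}g(t)\,dt$ is the Laplace transform of $g$.
   Context: Base stations: $\Pi_B=\{y_0,y_1,\dots\}$ is a homogeneous Poisson point process on $\mathbb{R}^2$ of intensity $\lambda_B$. Path loss: $L$ is a positive measurable function on $\mathbb{R}^2$; in the path loss exponent model $K,\gamma>0$ are constants and $|z|$ is the Euclidean norm. Fading: $H$ is a nonnegative random variable with probability density function $p_H$ and complementary cumulative distribution function $F_H(\beta)=P(H\ge\beta)=\int_\beta^\infty p_H(t)\,dt>0$. The fading variables $h_{y,x}$, $x,y\in\mathbb{R}^2$, are independent copies of $H$, serving as independent marks of the base stations. Define $B(\beta)=\int_{\mathbb{R}^2}F_H\big((L(z)\beta)^{-1}\big)\,dz$; it is assumed that $0<B(\beta)<\infty$ for all $\beta>0$. $B'$ denotes the derivative of $B$. For $x\in\mathbb{R}^2$ set $s_i^x=\big(h_{y_i x}L(y_i-x)\big)^{-1}$; the points of $\{s_i^x\}_{i\ge0}$ arranged in increasing order are denoted $\xi_0^x<\xi_1^x<\cdots$,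 so $\xi_0^x$ is the smallest one (the path loss fading of the best server of a user at $x$). A capacity function is a nonnegative measurable function $f$ on the positive half-line, evaluated at the path loss fading.
   Formalization: The second formula as printed lacks a factor: for f = 1 its left side is 1 and its right side is 1/(λ_B C). The theorem proved is E(f(ξ_0^x)) = λ_B C · L_{f~}(λ_B C), with C, f~ and the Laplace transform unchanged. *)

theory Defs
  imports "HOL-Probability.Probability"
begin

type_synonym plane = "real ^ 2"

(* Points are counted by index. The finiteness clause is needed because card of an infinite set
   is 0. The Poisson weights are written out because poisson_pmf requires a positive rate, whereas
   null sets A have rate 0. *)
definition homogeneous_PPP :: "'w measure \<Rightarrow> real \<Rightarrow> (nat \<Rightarrow> 'w \<Rightarrow> plane) \<Rightarrow> bool" where
  "homogeneous_PPP M lam y \<longleftrightarrow>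
     (\<forall>i. y i \<in> borel_measurable M) \<and>
     (AE w in M. inj (\<lambda>i. y i w)) \<and>
     (\<forall>A \<in> sets borel. emeasure lborel A < \<infinity> \<longrightarrow>
        (AE w in M. finite {i. y i w \<in> A}) \<and>
        (\<forall>k. measure M {w \<in> space M. card {i. y i w \<in> A} = k} =
           (lam * measure lborel A) ^ k / fact k * exp (- (lam * measure lborel A)))) \<and>
     (\<forall>A :: nat \<Rightarrow> plane set.
        (\<forall>j. A j \<in> sets borel \<and> emeasure lborel (A j) < \<infinity>) \<and> disjoint_family A \<longrightarrow>
        prob_space.indep_vars M (\<lambda>_. count_space UNIV)
          (\<lambda>j w. card {i. y i w \<in> A j}) UNIV)"

(* h i x is the fading variable between the base station y_i and a user at x, i.e. the mark of
   index i stands for the variable written h_{y_i, x}. *)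
definition independent_fading_marks ::
  "'w measure \<Rightarrow> (nat \<Rightarrow> 'w \<Rightarrow> plane) \<Rightarrow> ('w \<Rightarrow> real) \<Rightarrow> (nat \<Rightarrow> plane \<Rightarrow> 'w \<Rightarrow> real) \<Rightarrow> bool" where
  "independent_fading_marks M y H h \<longleftrightarrow>
     (\<forall>i x. distr M borel (h i x) = distr M borel H) \<and>
     prob_space.indep_vars M (\<lambda>_. borel) (\<lambda>p. h (fst p) (snd p)) UNIV \<and>
     prob_space.indep_set M
       {(\<lambda>w i. y i w) -` A \<inter> space M | A. A \<in> sets (\<Pi>\<^sub>M i\<in>UNIV. borel)}
       {(\<lambda>w p. h (fst p) (snd p) w) -` A \<inter> space M | A. A \<in> sets (\<Pi>\<^sub>M p\<in>UNIV. borel)}"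

definition path_loss_function :: "(plane \<Rightarrow> real) \<Rightarrow> bool" where
  "path_loss_function L \<longleftrightarrow> L \<in> borel_measurable borel \<and> (\<forall>z. 0 < L z)"

(* The value at the origin, where |z| powr (-gamma) is singular, is left free. *)
definition path_loss_exponent_model :: "real \<Rightarrow> real \<Rightarrow> (plane \<Rightarrow> real) \<Rightarrow> bool" where
  "path_loss_exponent_model K \<gamma> L \<longleftrightarrow> (\<forall>z. z \<noteq> 0 \<longrightarrow> L z = K * norm z powr (- \<gamma>))"

definition ccdf :: "'w measure \<Rightarrow> ('w \<Rightarrow> real) \<Rightarrow> real \<Rightarrow> real" where
  "ccdf M H \<beta> = measure M {w \<in> space M. \<beta> \<le> H w}"

definition B_ext :: "'w measure \<Rightarrow> ('w \<Rightarrow> real) \<Rightarrow> (plane \<Rightarrow> real) \<Rightarrow> real \<Rightarrow> ennreal" where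
  "B_ext M H L \<beta> = (\<integral>\<^sup>+ z. ennreal (ccdf M H (inverse (L z * \<beta>))) \<partial>lborel)"

definition B_fun :: "'w measure \<Rightarrow> ('w \<Rightarrow> real) \<Rightarrow> (plane \<Rightarrow> real) \<Rightarrow> real \<Rightarrow> real" where
  "B_fun M H L \<beta> = enn2real (B_ext M H L \<beta>)"

(* h i x w = 0 yields the value 0 instead of infinity; this is a null event when the fading
   distribution has a density. *)
definition path_loss_fading ::
  "(nat \<Rightarrow> 'w \<Rightarrow> plane) \<Rightarrow> (nat \<Rightarrow> plane \<Rightarrow> 'w \<Rightarrow> real) \<Rightarrow> (plane \<Rightarrow> real) \<Rightarrow>
   plane \<Rightarrow> nat \<Rightarrow> 'w \<Rightarrow> real" where
  "path_loss_fading y h L x i w = inverse (h i x w * L (y i w - x))"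

definition increasing_point :: "real set \<Rightarrow> nat \<Rightarrow> real" where
  "increasing_point S k = (THE t. t \<in> S \<and> finite {u \<in> S. u < t} \<and> card {u \<in> S. u < t} = k)"

definition ordered_path_loss_fading ::
  "(nat \<Rightarrow> 'w \<Rightarrow> plane) \<Rightarrow> (nat \<Rightarrow> plane \<Rightarrow> 'w \<Rightarrow> real) \<Rightarrow> (plane \<Rightarrow> real) \<Rightarrow>
   plane \<Rightarrow> nat \<Rightarrow> 'w \<Rightarrow> real" where
  "ordered_path_loss_fading y h L x k w =
     increasing_point (range (\<lambda>i. path_loss_fading y h L x i w)) k"

definition capacity_function :: "(real \<Rightarrow> real) \<Rightarrow> bool" where
  "capacity_function f \<longleftrightarrow>
     f \<in> borel_measurable (restrict_space borel {0<..}) \<and> (\<forall>t>0. 0 \<le> f t)"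

(* Extended-valued: the integral of a nonnegative g may diverge. *)
definition laplace_transform :: "(real \<Rightarrow> real) \<Rightarrow> real \<Rightarrow> ennreal" where
  "laplace_transform g s = (\<integral>\<^sup>+ t\<in>{0<..}. ennreal (exp (- (s * t)) * g t) \<partial>lborel)"

end

theory Submission
  imports Defs
begin

text \<open>
  The best server of a user at \<^term>\<open>x\<close> has path loss fading above \<^term>\<open>\<beta>\<close> exactly when no base
  station reaches the user at level \<^term>\<open>\<beta>\<close>. Given the positions of the stations, the station
  at \<^term>\<open>z\<close> reaches the user with probability \<open>g(z) = F\<^sub>H(1 / (L(z - x) \<beta>))\<close>, independently of the
  others, so the probability of the event is \<open>E (\<Prod>i. 1 - g(y\<^sub>i))\<close>. For a Poisson process this
  expectation is \<open>exp (- \<lambda>\<^sub>B \<integral> g)\<close>, and \<open>\<integral> g = B(\<beta>)\<close> by translation invariance. Hence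
  \<open>P (\<xi>\<^sub>0 > \<beta>) = exp (- \<lambda>\<^sub>B B(\<beta>))\<close> (\<open>prob_no_server\<close>, which rests on \<open>expectation_void_product\<close>
  for the points and on \<open>emeasure_marked_points\<close> for the marks).

  Two points need care. First, a smallest path loss fading has to exist almost surely.
  Expanding \<open>E (\<Prod>i. 1 - \<theta> g(y\<^sub>i))\<close> to first order at \<open>\<theta> = 0\<close> bounds the expected number of
  stations that reach the user by \<open>\<lambda>\<^sub>B B(\<beta>)\<close>, and Borel-Cantelli makes this number finite for
  every \<^term>\<open>\<beta>\<close> (\<open>AE_finite_fade_le\<close>).

  Secondly, the function \<open>B\<close> is not assumed to be differentiable, so differentiating the
  distribution function of \<open>\<xi>\<^sub>0\<close> does not by itself give a density. The fading variables have
  a density, hence every single path loss fading has an absolutely continuous law, and so has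
  \<open>\<xi>\<^sub>0\<close>, which is always one of countably many of them (\<open>best_absolutely_continuous\<close>). By
  Radon-Nikodym \<open>\<xi>\<^sub>0\<close> has a density, and by Lebesgue differentiation
  (\<open>AE_cdf_has_derivative_density\<close>) that density is almost everywhere the derivative of the
  distribution function \<open>1 - exp (- \<lambda>\<^sub>B B)\<close>, that is \<open>\<lambda>\<^sub>B B' exp (- \<lambda>\<^sub>B B)\<close>. In particular
  \<open>B\<close> turns out to be differentiable almost everywhere.

  In the path loss exponent model the stations that reach the user at a given fading value form
  a disc, so \<open>B(\<beta>) = C \<beta>\<^bsup>2/\<gamma>\<^esup>\<close>. Then \<open>\<xi>\<^sub>0\<^bsup>2/\<gamma>\<^esup>\<close> is exponentially distributed with rate
  \<open>\<lambda>\<^sub>B C\<close>, and its expectation against \<open>f(t\<^bsup>\<gamma>/2\<^esup>)\<close> is a Laplace transform.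
\<close>

section \<open>Lebesgue differentiation of distribution functions\<close>

lemma AE_right_averages_tendsto:
  fixes q :: "real \<Rightarrow> real"
  assumes "integrable lborel q"
  shows "AE x in lborel. ((\<lambda>h. integral {x..x + h} q / h) \<longlongrightarrow> q x) (at_right 0)"
proof -
  have int: "q integrable_on cbox a b" for a b
    using integrable_on_lborel[OF assms] by (rule integrable_on_subcbox) auto
  obtain N where "negligible N" and N: "\<And>x e. x \<notin> N \<Longrightarrow> 0 < e \<Longrightarrow>
      \<exists>d>0. \<forall>h. 0 < h \<and> h < d \<longrightarrow>
        norm (integral (cbox x (x + h *\<^sub>R One)) q /\<^sub>R h ^ DIM(real) - q x) < e"
    using integrable_ccontinuous_explicit[OF int] by metis
  have "((\<lambda>h. integral {x..x + h} q / h) \<longlongrightarrow> q x) (at_right 0)" if "x \<notin> N" for x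
  proof (rule tendstoI)
    fix e :: real assume "0 < e"
    then obtain d where "0 < d" "\<And>h. 0 < h \<Longrightarrow> h < d \<Longrightarrow> 
        norm (integral (cbox x (x + h *\<^sub>R One)) q /\<^sub>R h ^ DIM(real) - q x) < e"
      using N[OF \<open>x \<notin> N\<close>] by blast
    then show "eventually (\<lambda>h. dist (integral {x..x + h} q / h) (q x) < e) (at_right 0)"
      unfolding eventually_at_right_field
      by (intro exI[of _ d]) (auto simp: dist_norm divide_inverse mult.commute)
  qed
  moreover have "AE x in lborel. x \<notin> N"
    using \<open>negligible N\<close> AE_completion_iff[of "\<lambda>x. x \<notin> N" lborel] AE_not_in
    by (auto simp: negligible_iff_null_sets)
  ultimately show ?thesis by auto
qed

text \<open>
  Reflecting the line turns the averages to the left of a point into averages to the right.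
\<close>

lemma AE_left_averages_tendsto:
  fixes q :: "real \<Rightarrow> real"
  assumes "integrable lborel q"
  shows "AE x in lborel. ((\<lambda>h. integral {x - h..x} q / h) \<longlongrightarrow> q x) (at_right 0)"
proof -
  have "integrable lborel (\<lambda>t. q (- t))"
    using lborel_integrable_real_affine[OF assms, of "- 1" 0] by simp
  from AE_right_averages_tendsto[OF this]
  have "AE x in distr lborel borel uminus.
      ((\<lambda>h. integral {x..x + h} (\<lambda>t. q (- t)) / h) \<longlongrightarrow> q (- x)) (at_right 0)"
    by (subst lborel_distr_uminus)
  from AE_distrD[OF _ this] have "AE x in lborel.
      ((\<lambda>h. integral {- x..- x + h} (\<lambda>t. q (- t)) / h) \<longlongrightarrow> q x) (at_right 0)"
    by simp
  moreover have "integral {- x..- x + h} (\<lambda>t. q (- t)) = integral {x - h..x} q" for x h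
    using Henstock_Kurzweil_Integration.integral_reflect_real[of "x" "x - h" q] by simp
  ultimately show ?thesis by simp
qed

text \<open>
  The two families of one-sided averages of \<^term>\<open>q\<close> are the one-sided difference quotients of
  \<^term>\<open>G\<close>.
\<close>

lemma AE_cdf_has_derivative_density:
  fixes q :: "real \<Rightarrow> real"
  assumes q: "integrable lborel q"
    and G: "\<And>x. G x = (LINT t:{..x}|lborel. q t)"
  shows "AE x in lborel. (G has_real_derivative q x) (at x)"
proof -
  have incr: "G b - G a = integral {a..b} q" if "a \<le> b" for a b
  proof -
    have s: "set_integrable lborel A q" if "A \<in> sets borel" for A
      using q that unfolding set_integrable_def by (intro integrable_mult_indicator) auto
    have "{..b} = {..a} \<union> {a<..b}" using that by auto
    then have "G b = G a + (LINT t:{a<..b}|lborel. q t)"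
      unfolding G by (simp add: set_integral_Un[OF ivl_disj_int_one(3)] s)
    also have "(LINT t:{a<..b}|lborel. q t) = (LINT t:{a..b}|lborel. q t)"
      unfolding set_lebesgue_integral_def
      by (intro integral_cong_AE)
         (use q AE_lborel_singleton[of a] in \<open>auto split: split_indicator\<close>)
    also have "\<dots> = integral {a..b} q"
      by (intro set_borel_integral_eq_integral s) simp
    finally show ?thesis by simp
  qed
  have "(G has_real_derivative q x) (at x)"
    if r: "((\<lambda>h. integral {x..x + h} q / h) \<longlongrightarrow> q x) (at_right 0)"
      and l: "((\<lambda>h. integral {x - h..x} q / h) \<longlongrightarrow> q x) (at_right 0)" for x
  proof -
    have "((\<lambda>h. (G (x + h) - G x) / h) \<longlongrightarrow> q x) (at_right 0)"
      using r by (rule tendsto_cong[THEN iffD1, rotated])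
        (auto simp: eventually_at_right_field incr intro!: exI[of _ 1])
    moreover have "((\<lambda>h. (G (x + h) - G x) / h) \<longlongrightarrow> q x) (at_left 0)"
      unfolding at_left_minus[of "0 :: real"] filterlim_filtermap minus_zero
      using l by (rule tendsto_cong[THEN iffD1, rotated])
        (auto simp: eventually_at_right_field field_simps incr[symmetric] intro!: exI[of _ 1])
    ultimately show ?thesis
      unfolding DERIV_def by (rule filterlim_split_at[rotated])
  qed
  with AE_right_averages_tendsto[OF q] AE_left_averages_tendsto[OF q] show ?thesis
    by auto
qed

section \<open>The probability generating functional of a Poisson process\<close>

text \<open>
  The generating function of the Poisson law with mean \<^term>\<open>r\<close>. The mean \<open>r = 0\<close> is included,
  because it is the law of the number of points in a null set.
\<close>

lemma (in prob_space) expectation_power_poisson: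
  fixes N :: "'a \<Rightarrow> nat"
  assumes N[measurable]: "random_variable (count_space UNIV) N"
    and poisson: "\<And>k. prob {w \<in> space M. N w = k} = r ^ k / fact k * exp (- r)"
    and c: "0 \<le> c" "c \<le> 1"
  shows "expectation (\<lambda>w. c ^ N w) = exp (- (r * (1 - c)))"
proof -
  define p where "p k = prob {w \<in> space M. N w = k}" for k
  have D: "distr M (count_space UNIV) N = density (count_space UNIV) (\<lambda>k. ennreal (p k))"
  proof (rule measure_eqI_countable[where A=UNIV])
    fix k :: nat
    have "emeasure (distr M (count_space UNIV) N) {k} = emeasure M (N -` {k} \<inter> space M)"
      by (simp add: emeasure_distr)
    also have "N -` {k} \<inter> space M = {w \<in> space M. N w = k}"
      by auto
    finally show "emeasure (distr M (count_space UNIV) N) {k} =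
        emeasure (density (count_space UNIV) (\<lambda>k. ennreal (p k))) {k}"
      by (simp add: p_def emeasure_eq_measure emeasure_density nn_integral_count_space_indicator[symmetric]
          nn_integral_count_space_finite)
  qed auto
  have sums: "(\<lambda>k. p k * c ^ k) sums (exp (r * c) * exp (- r))"
    using sums_mult2[OF exp_converges[of "r * c"], of "exp (- r)"]
    by (simp add: p_def poisson power_mult_distrib field_simps)
  have nonneg: "0 \<le> p k * c ^ k" for k
    using c by (simp add: p_def)
  have "expectation (\<lambda>w. c ^ N w) = integral\<^sup>L (distr M (count_space UNIV) N) (\<lambda>k. c ^ k)"
    by (simp add: integral_distr)
  also have "\<dots> = integral\<^sup>L (count_space UNIV) (\<lambda>k. p k * c ^ k)"
    unfolding D by (subst integral_density) (auto simp: p_def)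
  also have "\<dots> = (\<Sum>k. p k * c ^ k)"
    using sums nonneg by (intro integral_count_space_nat)
      (simp add: integrable_count_space_nat_iff sums_iff)
  also have "\<dots> = exp (- (r * (1 - c)))"
    using sums by (simp add: sums_iff exp_add[symmetric] algebra_simps)
  finally show ?thesis .
qed

text \<open>
  The infinite product \<open>\<Prod>i. 1 - a\<^sub>i\<close>. For factors in the unit interval the partial products
  decrease, and their infimum, unlike an infinite product in the sense of convergence theory, is
  meaningful also when it is zero or contains zero factors.
\<close>

definition void_product :: "(nat \<Rightarrow> real) \<Rightarrow> real" where
  "void_product a = (INF k. \<Prod>i<k. 1 - a i)"

lemma decseq_void_product: 
  assumes "\<And>i. 0 \<le> a i \<and> a i \<le> 1"
  shows "decseq (\<lambda>k. \<Prod>i<k. 1 - a i :: real)"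
  using assms by (intro decseq_SucI) (auto intro!: mult_right_le_one_le prod_nonneg)

lemma tendsto_void_product:
  assumes "\<And>i. 0 \<le> a i \<and> a i \<le> 1"
  shows "(\<lambda>k. \<Prod>i<k. 1 - a i) \<longlonglongrightarrow> void_product a"
  unfolding void_product_def
  using assms
  by (intro LIMSEQ_decseq_INF decseq_void_product bdd_belowI2[of _ 0] prod_nonneg) auto

lemma void_product_le:
  assumes "\<And>i. 0 \<le> a i \<and> a i \<le> 1"
  shows "void_product a \<le> (\<Prod>i<k. 1 - a i)"
  using decseq_ge[OF decseq_void_product tendsto_void_product] assms by blast

lemma void_product_bounds:
  assumes "\<And>i. 0 \<le> a i \<and> a i \<le> 1"
  shows "0 \<le> void_product a" "void_product a \<le> 1"
proof -
  show "0 \<le> void_product a"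
    using assms by (intro LIMSEQ_le_const[OF tendsto_void_product]) (auto intro!: prod_nonneg)
  show "void_product a \<le> 1"
    using void_product_le[OF assms, where k=0] by simp
qed

text \<open>
  Both limits, over the partial products and over \<^term>\<open>n\<close>, are decreasing, hence infima, and
  infima commute.
\<close>

lemma tendsto_void_product_incseq:
  assumes a: "\<And>n i. 0 \<le> a n i \<and> a n i \<le> b i" and b: "\<And>i. b i \<le> 1"
    and lim: "\<And>i. (\<lambda>n. a n i) \<longlonglongrightarrow> b i"
  shows "(\<lambda>n. void_product (a n)) \<longlonglongrightarrow> void_product b"
proof -
  have a01: "0 \<le> a n i \<and> a n i \<le> 1" for n i
    using a b order_trans by blast
  have b01: "0 \<le> b i \<and> b i \<le> 1" for i
    using a b order_trans by blast
  have ge: "void_product b \<le> void_product (a n)" for n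
    using a b by (intro LIMSEQ_le[OF tendsto_void_product[OF b01] tendsto_void_product[OF a01]]
      exI[of _ 0] allI impI prod_mono) auto
  show ?thesis
  proof (rule order_tendstoI)
    fix t assume "t < void_product b"
    then show "eventually (\<lambda>n. t < void_product (a n)) sequentially"
      using ge by (intro always_eventually allI) (rule less_le_trans)
  next
    fix t assume "void_product b < t"
    from order_tendstoD(2)[OF tendsto_void_product[OF b01] this]
    obtain k where "(\<Prod>i<k. 1 - b i) < t"
      by (auto simp: eventually_sequentially)
    moreover have "(\<lambda>n. \<Prod>i<k. 1 - a n i) \<longlonglongrightarrow> (\<Prod>i<k. 1 - b i)"
      by (intro tendsto_intros lim)
    ultimately have "eventually (\<lambda>n. (\<Prod>i<k. 1 - a n i) < t) sequentially"
      by (intro order_tendstoD(2))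
    then show "eventually (\<lambda>n. void_product (a n) < t) sequentially"
      using void_product_le[OF a01] by (elim eventually_mono) (rule le_less_trans)
  qed
qed

text \<open>
  A point in \<open>A\<^sub>j\<close> contributes the factor \<open>1 - c\<^sub>j\<close> and a point outside all the sets contributes
  1, so only the numbers of points in the sets matter.
\<close>

lemma void_product_step:
  fixes A :: "nat \<Rightarrow> 'a set"
  assumes disj: "disjoint_family A" and c: "\<And>j. 0 \<le> c j \<and> c j \<le> 1"
    and fin: "\<And>j. finite {i. x i \<in> A j}"
  shows "void_product (\<lambda>i. \<Sum>j<m. c j * indicator (A j) (x i)) =
    (\<Prod>j<m. (1 - c j) ^ card {i. x i \<in> A j})"
proof -
  have factor: "1 - (\<Sum>j<m. c j * indicator (A j) z) = (\<Prod>j<m. if z \<in> A j then 1 - c j else 1)" for z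
  proof (cases "\<exists>j<m. z \<in> A j")
    case True
    then obtain j where j: "j < m" "z \<in> A j" by blast
    then have only: "z \<in> A l \<longleftrightarrow> l = j" for l
      using disj by (auto simp: disjoint_family_on_def)
    have "(\<Sum>l<m. c l * indicator (A l) z) = (\<Sum>l<m. if l = j then c j else 0)"
      by (intro sum.cong) (auto simp: only indicator_def)
    moreover have "(\<Prod>l<m. if z \<in> A l then 1 - c l else 1) = (\<Prod>l<m. if l = j then 1 - c j else 1)"
      by (intro prod.cong) (auto simp: only)
    ultimately show ?thesis using j by simp
  qed simp
  have a01: "0 \<le> (\<Sum>j<m. c j * indicator (A j) (x i)) \<and> (\<Sum>j<m. c j * indicator (A j) (x i)) \<le> 1" for i
  proof -
    have "0 \<le> (\<Prod>j<m. if x i \<in> A j then 1 - c j else 1)"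
      using c by (intro prod_nonneg) auto
    then show ?thesis
      using c unfolding factor[symmetric] by (auto intro!: sum_nonneg)
  qed
  \<comment> \<open>From the index \<open>K\<close> on no point lies in any of the sets, so the partial products are
    constant.\<close>
  have "finite (\<Union>j<m. {i. x i \<in> A j})"
    using fin by auto
  then obtain K where K: "\<And>i j. j < m \<Longrightarrow> x i \<in> A j \<Longrightarrow> i < K"
    unfolding finite_nat_set_iff_bounded by blast
  have "(\<Prod>i<k. 1 - (\<Sum>j<m. c j * indicator (A j) (x i))) = (\<Prod>j<m. (1 - c j) ^ card {i. x i \<in> A j})"
    if "K \<le> k" for k
  proof -
    have "(\<Prod>i<k. if x i \<in> A j then 1 - c j else 1) = (1 - c j) ^ card {i. x i \<in> A j}" if "j < m" for j
    proof -
      have "{i. x i \<in> A j} = {i \<in> {..<k}. x i \<in> A j}"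
        using K[OF that] \<open>K \<le> k\<close> by fastforce
      then show ?thesis
        by (simp add: prod.If_cases Int_def)
    qed
    then show ?thesis
      unfolding factor by (subst prod.swap) simp
  qed
  then have "(\<lambda>k. \<Prod>i<k. 1 - (\<Sum>j<m. c j * indicator (A j) (x i)))
      \<longlonglongrightarrow> (\<Prod>j<m. (1 - c j) ^ card {i. x i \<in> A j})"
    by (intro tendsto_eventually) (auto simp: eventually_sequentially)
  from LIMSEQ_unique[OF tendsto_void_product[OF a01] this] show ?thesis .
qed

locale poisson_points = prob_space M for M :: "'w measure" +
  fixes lam :: real and y :: "nat \<Rightarrow> 'w \<Rightarrow> plane"
  assumes PPP: "homogeneous_PPP M lam y"
begin

lemma y_measurable [measurable]: "y i \<in> borel_measurable M"
  using PPP by (simp add: homogeneous_PPP_def)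

lemma void_product_measurable [measurable]:
  assumes [measurable]: "g \<in> borel_measurable borel"
  shows "(\<lambda>w. void_product (\<lambda>i. g (y i w))) \<in> borel_measurable M"
  unfolding void_product_def by measurable

lemma
  assumes "A \<in> sets borel" "emeasure lborel A < \<infinity>"
  shows AE_finite_count: "AE w in M. finite {i. y i w \<in> A}"
    and prob_count: "prob {w \<in> space M. card {i. y i w \<in> A} = k} =
      (lam * measure lborel A) ^ k / fact k * exp (- (lam * measure lborel A))"
  using PPP[unfolded homogeneous_PPP_def, THEN conjunct2, THEN conjunct2, THEN conjunct1,
    rule_format, OF assms] by (simp_all only: simp_thms)

lemma indep_counts:
  fixes A :: "nat \<Rightarrow> plane set"
  assumes "\<And>j. A j \<in> sets borel" "\<And>j. emeasure lborel (A j) < \<infinity>" "disjoint_family A"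
  shows "indep_vars (\<lambda>_. count_space UNIV) (\<lambda>j w. card {i. y i w \<in> A j}) UNIV"
  by (rule PPP[unfolded homogeneous_PPP_def, THEN conjunct2, THEN conjunct2, THEN conjunct2,
    THEN spec[where x=A], THEN mp]) (use assms in simp)

text \<open>
  The counts in disjoint sets are independent Poisson variables, so the expectation factorises
  into Poisson generating functions.
\<close>

lemma expectation_void_product_step:
  fixes A :: "nat \<Rightarrow> plane set"
  assumes A: "\<And>j. A j \<in> sets borel" "\<And>j. emeasure lborel (A j) < \<infinity>"
    and disj: "disjoint_family A" and c: "\<And>j. 0 \<le> c j \<and> c j \<le> 1"
  shows "expectation (\<lambda>w. void_product (\<lambda>i. \<Sum>j<m. c j * indicator (A j) (y i w))) =
    exp (- (lam * (\<Sum>j<m. c j * measure lborel (A j))))"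
proof -
  define N where "N j w = card {i. y i w \<in> A j}" for j w
  have indep: "indep_vars (\<lambda>_. count_space UNIV) N UNIV"
    unfolding N_def using indep_counts[OF A disj] .
  then have [measurable]: "random_variable (count_space UNIV) (N j)" for j
    by (simp add: indep_vars_def)
  have pois: "prob {w \<in> space M. N j w = k} =
      (lam * measure lborel (A j)) ^ k / fact k * exp (- (lam * measure lborel (A j)))" for j k
    unfolding N_def using prob_count[OF A] .
  have "AE w in M. \<forall>j. finite {i. y i w \<in> A j}"
    unfolding AE_all_countable using AE_finite_count[OF A] by blast
  then have "AE w in M. void_product (\<lambda>i. \<Sum>j<m. c j * indicator (A j) (y i w)) =
      (\<Prod>j<m. (1 - c j) ^ N j w)"
    unfolding N_def by eventually_elim (intro void_product_step disj c, blast)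
  then have "expectation (\<lambda>w. void_product (\<lambda>i. \<Sum>j<m. c j * indicator (A j) (y i w))) =
      expectation (\<lambda>w. \<Prod>j<m. (1 - c j) ^ N j w)"
  proof (intro integral_cong_AE)
    have [measurable]: "A j \<in> sets borel" for j
      by (rule A)
    show "(\<lambda>w. void_product (\<lambda>i. \<Sum>j<m. c j * indicator (A j) (y i w))) \<in> borel_measurable M"
      by (rule void_product_measurable) measurable
  qed measurable
  also have "\<dots> = (\<Prod>j<m. expectation (\<lambda>w. (1 - c j) ^ N j w))"
  proof (rule indep_vars_lebesgue_integral)
    show "indep_vars (\<lambda>_. borel) (\<lambda>j w. (1 - c j) ^ N j w) {..<m}"
      by (rule indep_vars_compose2[OF indep_vars_subset[OF indep]]) auto
    show "integrable M (\<lambda>w. (1 - c j) ^ N j w)" for j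
      using c by (intro integrable_const_bound[where B=1]) (auto intro!: power_le_one)
  qed simp
  also have "\<dots> = (\<Prod>j<m. exp (- (lam * measure lborel (A j) * c j)))"
    using c by (intro prod.cong refl) (subst expectation_power_poisson[OF _ pois], auto)
  also have "\<dots> = exp (- (lam * (\<Sum>j<m. c j * measure lborel (A j))))"
    by (simp add: exp_sum[symmetric] sum_negf sum_distrib_left mult_ac)
  finally show ?thesis .
qed

lemma expectation_void_product_simple:
  assumes s: "simple_function lborel s" and s01: "\<And>z. 0 \<le> s z \<and> s z \<le> 1"
    and int: "integrable lborel s"
  shows "expectation (\<lambda>w. void_product (\<lambda>i. s (y i w))) = exp (- (lam * integral\<^sup>L lborel s))"
proof -
  have [measurable]: "s \<in> borel_measurable borel"
    using borel_measurable_simple_function[OF s] by simp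
  \<comment> \<open>The level sets of the nonzero values have finite measure and are enumerated by \<open>{..<m}\<close>; the
    sequence of sets is continued by empty sets.\<close>
  define V where "V = range s - {0}"
  have "finite V"
    using s by (auto simp: V_def simple_function_def)
  then obtain e where e: "bij_betw e {0..<card V} V"
    using ex_bij_betw_nat_finite by blast
  define m where "m = card V"
  define A where "A j = (if j < m then s -` {e j} else {})" for j
  define c where "c j = (if j < m then e j else 0)" for j
  have eV: "e j \<in> V" if "j < m" for j
    using e that by (auto simp: bij_betw_def m_def)
  have A_meas: "A j \<in> sets borel" for j
    using measurable_sets_borel[of s borel "{e j}"] by (auto simp: A_def)
  have A_fin: "emeasure lborel (A j) < \<infinity>" for j
  proof (cases "j < m")
    case True
    then have pos: "0 < e j"
      using eV[OF True] s01 by (force simp: V_def less_le)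
    have "emeasure lborel (A j) \<le> emeasure lborel {z \<in> space lborel. e j \<le> s z}"
      using True by (intro emeasure_mono) (auto simp: A_def)
    also have "\<dots> \<le> ennreal (1 / e j * integral\<^sup>L lborel s)"
      using integral_Markov_inequality[OF int _ pos] s01 by simp
    finally show ?thesis
      using le_less_trans by fastforce
  qed (simp add: A_def)
  have disj: "disjoint_family A"
    using e by (auto simp: disjoint_family_on_def A_def m_def bij_betw_def inj_on_def)
  have c: "0 \<le> c j \<and> c j \<le> 1" for j
    using eV s01 by (force simp: c_def V_def)
  have s_eq: "s z = (\<Sum>j<m. c j * indicator (A j) z)" for z
  proof (cases "s z = 0")
    case True
    then show ?thesis
      using eV by (auto simp: c_def A_def V_def indicator_def intro!: sum.neutral[symmetric])
  next
    case False
    then have "s z \<in> V"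
      by (simp add: V_def)
    then have "s z \<in> e ` {0..<m}"
      using e by (simp add: bij_betw_def m_def)
    then obtain j where j: "j < m" "s z = e j"
      by auto
    then have "z \<in> A l \<longleftrightarrow> l = j" for l
      using e by (auto simp: A_def m_def bij_betw_def inj_on_def)
    then have "(\<Sum>l<m. c l * indicator (A l) z) = (\<Sum>l<m. if l = j then c j else 0)"
      by (intro sum.cong) (auto simp: indicator_def)
    then show ?thesis
      using j by (simp add: c_def)
  qed
  have "integral\<^sup>L lborel s = (\<Sum>j<m. c j * measure lborel (A j))"
    unfolding s_eq using A_meas A_fin
    by (subst Bochner_Integration.integral_sum)
       (auto intro!: integrable_mult_right integrable_real_indicator)
  then show ?thesis
    unfolding s_eq using expectation_void_product_step[OF A_meas A_fin disj c] by simp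
qed

text \<open>
  The probability generating functional of the Poisson process: approximate \<^term>\<open>g\<close> from below
  by simple functions.
\<close>

theorem expectation_void_product:
  assumes [measurable]: "g \<in> borel_measurable borel" and g01: "\<And>z. 0 \<le> g z \<and> g z \<le> 1"
    and int: "integrable lborel g"
  shows "expectation (\<lambda>w. void_product (\<lambda>i. g (y i w))) = exp (- (lam * integral\<^sup>L lborel g))"
proof -
  have "g \<in> borel_measurable lborel" by simp
  from borel_measurable_implies_simple_function_sequence_real[OF this g01[THEN conjunct1]]
  obtain s where "incseq s \<and> (\<forall>n. simple_function lborel (s n)) \<and>
      (\<forall>z. bdd_above (range (\<lambda>n. s n z))) \<and> (\<forall>n z. 0 \<le> s n z) \<and> g = (SUP n. s n)"
    by (rule exE)
  then have s: "incseq s" "\<And>n. simple_function lborel (s n)"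
      "\<And>z. bdd_above (range (\<lambda>n. s n z))" "\<And>n z. 0 \<le> s n z" "g = (SUP n. s n)"
    by simp_all
  have lim: "(\<lambda>n. s n z) \<longlonglongrightarrow> g z" for z
    using LIMSEQ_incseq_SUP[OF s(3)[of z]] s(1) by (simp add: s(5) incseq_def le_fun_def image_comp)
  have le: "s n z \<le> g z" for n z
    using incseq_le[OF _ lim] s(1) by (simp add: incseq_def le_fun_def)
  have s01: "0 \<le> s n z \<and> s n z \<le> 1" for n z
    using s(4) le g01 order_trans by blast
  have [measurable]: "s n \<in> borel_measurable borel" for n
    using borel_measurable_simple_function[OF s(2)] by simp
  have s_int: "integrable lborel (s n)" for n
    by (rule Bochner_Integration.integrable_bound[OF int]) (auto simp: le s(4) abs_of_nonneg g01)
  have "(\<lambda>n. integral\<^sup>L lborel (s n)) \<longlonglongrightarrow> integral\<^sup>L lborel g"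
    using int by (rule integral_dominated_convergence[where w=g, rotated 2])
      (auto simp: lim le s(4) abs_of_nonneg g01)
  then have "(\<lambda>n. exp (- (lam * integral\<^sup>L lborel (s n)))) \<longlonglongrightarrow> exp (- (lam * integral\<^sup>L lborel g))"
    by (intro tendsto_intros)
  moreover have "(\<lambda>n. expectation (\<lambda>w. void_product (\<lambda>i. s n (y i w))))
      \<longlonglongrightarrow> expectation (\<lambda>w. void_product (\<lambda>i. g (y i w)))"
  proof (rule integral_dominated_convergence[where w="\<lambda>_. 1"])
    show "AE w in M. (\<lambda>n. void_product (\<lambda>i. s n (y i w))) \<longlonglongrightarrow> void_product (\<lambda>i. g (y i w))"
      using s(4) le g01 lim by (intro AE_I2 tendsto_void_product_incseq) auto
    show "AE w in M. norm (void_product (\<lambda>i. s n (y i w))) \<le> 1" for n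
      using void_product_bounds[of "\<lambda>i. s n (y i w)" for w] s01 by (intro AE_I2) auto
  qed auto
  ultimately show ?thesis
    unfolding expectation_void_product_simple[OF s(2) s01 s_int] by (rule LIMSEQ_unique[rotated])
qed

end

text \<open>
  A Bonferroni inequality with a crude error term, which still vanishes after division by
  \<^term>\<open>t\<close> as \<^term>\<open>t\<close> tends to 0.
\<close>

lemma bonferroni_prod_le:
  fixes a :: "nat \<Rightarrow> real"
  assumes a: "\<And>i. 0 \<le> a i \<and> a i \<le> 1" and t: "0 \<le> t" "t \<le> 1"
  shows "(\<Prod>i<k. 1 - t * a i) \<le> 1 - t * (\<Sum>i<k. a i) + t\<^sup>2 * (real k)\<^sup>2"
proof (induction k)
  case (Suc k)
  have ta: "0 \<le> t * a k" "t * a k \<le> 1"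
    using a[of k] t mult_mono[of t 1 "a k" 1] by auto
  have "(\<Sum>i<k. a i) \<le> real k"
    using sum_mono[of "{..<k}" a "\<lambda>_. 1"] a by simp
  moreover have "0 \<le> (\<Sum>i<k. a i)"
    using a by (intro sum_nonneg) auto
  ultimately have S: "a k * (\<Sum>i<k. a i) \<le> real k"
    using a[of k] mult_mono[of "a k" 1 "\<Sum>i<k. a i" "real k"] by simp
  have "(\<Prod>i<Suc k. 1 - t * a i) \<le> (1 - t * (\<Sum>i<k. a i) + t\<^sup>2 * (real k)\<^sup>2) * (1 - t * a k)"
    using Suc.IH ta by (simp add: mult_right_mono)
  also have "\<dots> = 1 - t * (\<Sum>i<Suc k. a i) + t\<^sup>2 * (real k)\<^sup>2 + t\<^sup>2 * (a k * (\<Sum>i<k. a i))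
      - t\<^sup>2 * (real k)\<^sup>2 * (t * a k)"
    by (simp add: power2_eq_square algebra_simps)
  also have "\<dots> \<le> 1 - t * (\<Sum>i<Suc k. a i) + t\<^sup>2 * (real k)\<^sup>2 + t\<^sup>2 * real k"
  proof -
    have "0 \<le> t\<^sup>2 * (real k)\<^sup>2 * (t * a k)"
      using a[of k] t by simp
    moreover have "t\<^sup>2 * (a k * (\<Sum>i<k. a i)) \<le> t\<^sup>2 * real k"
      using S by (rule mult_left_mono) simp
    ultimately show ?thesis by linarith
  qed
  also have "\<dots> \<le> 1 - t * (\<Sum>i<Suc k. a i) + t\<^sup>2 * (real (Suc k))\<^sup>2"
  proof -
    have "(real k)\<^sup>2 + real k \<le> (real (Suc k))\<^sup>2"
      by (simp add: power2_eq_square algebra_simps)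
    from mult_left_mono[OF this, of "t\<^sup>2"] show ?thesis
      by (simp add: distrib_left)
  qed
  finally show ?case .
qed simp

context poisson_points
begin

text \<open>
  One half of Campbell's formula: the expected sum of \<^term>\<open>g\<close> over the points is at most
  \<open>\<lambda> \<integral> g\<close>. It is the first-order part of \<open>expectation_void_product\<close> for \<open>t g\<close> as \<open>t\<close> tends
  to 0. The bound does not depend on \<^term>\<open>k\<close>, which is what Borel-Cantelli requires.
\<close>

lemma sum_expectation_le:
  assumes [measurable]: "g \<in> borel_measurable borel" and g01: "\<And>z. 0 \<le> g z \<and> g z \<le> 1"
    and int: "integrable lborel g"
  shows "(\<Sum>i<k. expectation (\<lambda>w. g (y i w))) \<le> lam * integral\<^sup>L lborel g"
proof (rule field_le_epsilon)
  fix e :: real assume "0 < e"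
  \<comment> \<open>Small enough for the quadratic error, divided by \<open>t\<close>, to be at most \<open>e\<close>.\<close>
  define t where "t = min 1 (e / ((real k)\<^sup>2 + 1))"
  have t: "0 < t" "t \<le> 1"
    using \<open>0 < e\<close> by (auto simp: t_def add_nonneg_pos)
  have "t \<le> e / ((real k)\<^sup>2 + 1)"
    by (simp add: t_def)
  then have te: "t * (real k)\<^sup>2 \<le> e"
    using t by (simp add: pos_le_divide_eq add_nonneg_pos distrib_left)
  have tg: "0 \<le> t * g z \<and> t * g z \<le> 1" for z
    using t g01[of z] mult_mono[of t 1 "g z" 1] by simp
  have int_g: "integrable M (\<lambda>w. g (y i w))" for i
    using g01 by (intro integrable_const_bound[where B=1]) auto
  have "1 - t * (lam * integral\<^sup>L lborel g) \<le> exp (- (lam * integral\<^sup>L lborel (\<lambda>z. t * g z)))"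
    using exp_ge_add_one_self[of "- (lam * integral\<^sup>L lborel (\<lambda>z. t * g z))"] by (simp add: mult_ac)
  also have "\<dots> = expectation (\<lambda>w. void_product (\<lambda>i. t * g (y i w)))"
    using int tg by (intro expectation_void_product[symmetric]) auto
  also have "\<dots> \<le> expectation (\<lambda>w. 1 - t * (\<Sum>i<k. g (y i w)) + t\<^sup>2 * (real k)\<^sup>2)"
  proof (rule integral_mono)
    show "integrable M (\<lambda>w. void_product (\<lambda>i. t * g (y i w)))"
      using void_product_bounds[of "\<lambda>i. t * g (y i w)" for w] tg
        void_product_measurable[of "\<lambda>z. t * g z"]
      by (intro integrable_const_bound[where B=1]) auto
    show "integrable M (\<lambda>w. 1 - t * (\<Sum>i<k. g (y i w)) + t\<^sup>2 * (real k)\<^sup>2)"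
      using int_g by (intro Bochner_Integration.integrable_add Bochner_Integration.integrable_diff
        integrable_mult_right Bochner_Integration.integrable_sum) auto
    show "void_product (\<lambda>i. t * g (y i w)) \<le> 1 - t * (\<Sum>i<k. g (y i w)) + t\<^sup>2 * (real k)\<^sup>2" for w
      using void_product_le[of "\<lambda>i. t * g (y i w)" k] tg
        bonferroni_prod_le[of "\<lambda>i. g (y i w)" t k] g01 t by force
  qed
  also have "\<dots> = 1 - t * (\<Sum>i<k. expectation (\<lambda>w. g (y i w))) + t\<^sup>2 * (real k)\<^sup>2"
    using int_g by (simp add: prob_space)
  finally have "t * (\<Sum>i<k. expectation (\<lambda>w. g (y i w))) \<le> t * (lam * integral\<^sup>L lborel g + t * (real k)\<^sup>2)"
    by (simp add: power2_eq_square algebra_simps)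
  then show "(\<Sum>i<k. expectation (\<lambda>w. g (y i w))) \<le> lam * integral\<^sup>L lborel g + e"
    using t te by simp
qed

end

section \<open>Independent fading marks\<close>

locale fading_network = poisson_points M lam y for M :: "'w measure" and lam y +
  fixes H :: "'w \<Rightarrow> real" and pH :: "real \<Rightarrow> real"
    and h :: "nat \<Rightarrow> plane \<Rightarrow> 'w \<Rightarrow> real" and L :: "plane \<Rightarrow> real"
  assumes lam_pos: "0 < lam"
    and path_loss: "path_loss_function L"
    and H_nonneg: "AE w in M. 0 \<le> H w"
    and H_density: "distributed M lborel H (\<lambda>t. ennreal (pH t))"
    and marks: "independent_fading_marks M y H h"
    and B_finite: "\<And>\<beta>. 0 < \<beta> \<Longrightarrow> 0 < B_ext M H L \<beta> \<and> B_ext M H L \<beta> < \<infinity>"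
begin

lemma H_measurable [measurable]: "H \<in> borel_measurable M"
  using distributed_measurable[OF H_density] by simp

lemma L_measurable [measurable]: "L \<in> borel_measurable borel"
  using path_loss by (simp add: path_loss_function_def)

lemma L_pos: "0 < L z"
  using path_loss by (simp add: path_loss_function_def)

lemma indep_fading: "indep_vars (\<lambda>_. borel) (\<lambda>p. h (fst p) (snd p)) UNIV"
  using marks by (simp add: independent_fading_marks_def)

lemma h_measurable [measurable]: "h i x \<in> borel_measurable M"
  using indep_vars_def[THEN iffD1, OF indep_fading] by (auto dest!: bspec[of _ _ "(i, x)"])

lemma distr_h: "distr M borel (h i x) = distr M borel H"
  using marks by (simp add: independent_fading_marks_def)

text \<open>
  The independence of the point process and the marks is given for the generated
  \<open>\<sigma>\<close>-algebras; as a product of laws it becomes accessible to Fubini's theorem.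
\<close>

lemma joint_law:
  defines "P \<equiv> (\<Pi>\<^sub>M i\<in>(UNIV :: nat set). (borel :: plane measure))"
    and "F \<equiv> (\<Pi>\<^sub>M p\<in>(UNIV :: (nat \<times> plane) set). (borel :: real measure))"
  shows "distr M (P \<Otimes>\<^sub>M F) (\<lambda>w. (\<lambda>i. y i w, \<lambda>p. h (fst p) (snd p) w)) =
    distr M P (\<lambda>w i. y i w) \<Otimes>\<^sub>M distr M F (\<lambda>w p. h (fst p) (snd p) w)"
proof -
  have Y: "(\<lambda>w i. y i w) \<in> measurable M P"
    unfolding P_def by (intro measurable_PiM_single') auto
  have Z: "(\<lambda>w p. h (fst p) (snd p) w) \<in> measurable M F"
    unfolding F_def by (intro measurable_PiM_single') auto
  interpret Y: prob_space "distr M P (\<lambda>w i. y i w)"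
    by (rule prob_space_distr[OF Y])
  interpret Z: prob_space "distr M F (\<lambda>w p. h (fst p) (snd p) w)"
    by (rule prob_space_distr[OF Z])
  have indep: "indep_set {(\<lambda>w i. y i w) -` A \<inter> space M |A. A \<in> sets P}
      {(\<lambda>w p. h (fst p) (snd p) w) -` A \<inter> space M |A. A \<in> sets F}"
    using marks unfolding independent_fading_marks_def P_def F_def by (elim conjE)
  have YZ: "(\<lambda>w. (\<lambda>i. y i w, \<lambda>p. h (fst p) (snd p) w)) \<in> measurable M (P \<Otimes>\<^sub>M F)"
    using Y Z by (rule measurable_Pair)
  show ?thesis
  proof (rule pair_measure_eqI[symmetric])
    fix A B
    assume "A \<in> sets (distr M P (\<lambda>w i. y i w))" "B \<in> sets (distr M F (\<lambda>w p. h (fst p) (snd p) w))"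
    then have A: "A \<in> sets P" and B: "B \<in> sets F" by simp_all
    have "(\<lambda>w. (\<lambda>i. y i w, \<lambda>p. h (fst p) (snd p) w)) -` (A \<times> B) \<inter> space M =
        ((\<lambda>w i. y i w) -` A \<inter> space M) \<inter> ((\<lambda>w p. h (fst p) (snd p) w) -` B \<inter> space M)"
      by auto
    moreover have "prob (((\<lambda>w i. y i w) -` A \<inter> space M) \<inter> ((\<lambda>w p. h (fst p) (snd p) w) -` B \<inter> space M)) =
        prob ((\<lambda>w i. y i w) -` A \<inter> space M) * prob ((\<lambda>w p. h (fst p) (snd p) w) -` B \<inter> space M)"
      using A B by (intro indep_setD[OF indep]) blast+
    ultimately show "emeasure (distr M P (\<lambda>w i. y i w)) A *
        emeasure (distr M F (\<lambda>w p. h (fst p) (snd p) w)) B =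
        emeasure (distr M (P \<Otimes>\<^sub>M F) (\<lambda>w. (\<lambda>i. y i w, \<lambda>p. h (fst p) (snd p) w))) (A \<times> B)"
      using A B by (simp add: emeasure_distr[OF Y] emeasure_distr[OF Z] emeasure_distr[OF YZ]
        emeasure_eq_measure ennreal_mult)
  qed (unfold_locales, simp cong: sets_pair_measure_cong)
qed

text \<open>
  Integrate out the marks first: for fixed points they are independent copies of \<^term>\<open>H\<close>, so the
  probability that all marked points in \<^term>\<open>J\<close> fall into \<^term>\<open>Q\<close> is a product.
\<close>

lemma emeasure_marked_points:
  assumes "finite J" and Q[measurable]: "Q \<in> sets (borel \<Otimes>\<^sub>M borel)"
  shows "emeasure M {w \<in> space M. \<forall>i\<in>J. (y i w, h i x w) \<in> Q} =
    (\<integral>\<^sup>+ w. (\<Prod>i\<in>J. emeasure M {w' \<in> space M. (y i w, H w') \<in> Q}) \<partial>M)"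
proof -
  define P where "P = (\<Pi>\<^sub>M i\<in>(UNIV :: nat set). (borel :: plane measure))"
  define F where "F = (\<Pi>\<^sub>M p\<in>(UNIV :: (nat \<times> plane) set). (borel :: real measure))"
  define Y where "Y w i = y i w" for i w
  define Z where "Z w p = h (fst p) (snd p) w" for p w
  have Y[measurable]: "Y \<in> measurable M P"
    unfolding P_def Y_def by (intro measurable_PiM_single') auto
  have Z[measurable]: "Z \<in> measurable M F"
    unfolding F_def Z_def by (intro measurable_PiM_single') auto
  have [measurable]: "(\<lambda>u. u i) \<in> borel_measurable P" "(\<lambda>v. v p) \<in> borel_measurable F" for i p
    unfolding P_def F_def by (auto intro: measurable_component_singleton)
  have joint: "distr M (P \<Otimes>\<^sub>M F) (\<lambda>w. (Y w, Z w)) = distr M P Y \<Otimes>\<^sub>M distr M F Z"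
    using joint_law unfolding P_def F_def Y_def[abs_def] Z_def[abs_def] .
  interpret Z: prob_space "distr M F Z"
    by (rule prob_space_distr) fact
  define E where "E = {uv \<in> space (P \<Otimes>\<^sub>M F). \<forall>i\<in>J. (fst uv i, snd uv (i, x)) \<in> Q}"
  have E: "E \<in> sets (P \<Otimes>\<^sub>M F)"
    unfolding E_def using \<open>finite J\<close> by measurable
  have inner: "emeasure (distr M F Z) (Pair (Y w) -` E) =
      (\<Prod>i\<in>J. emeasure M {w' \<in> space M. (y i w, H w') \<in> Q})" if w: "w \<in> space M" for w
  proof -
    define A where "A i = Pair (y i w) -` Q" for i
    have A[measurable]: "A i \<in> sets borel" for i
      unfolding A_def by (rule sets_Pair1[OF Q])
    have sec: "Pair (Y w) -` E \<in> sets F"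
      by (rule sets_Pair1[OF E])
    have "emeasure (distr M F Z) (Pair (Y w) -` E) = emeasure M (Z -` (Pair (Y w) -` E) \<inter> space M)"
      by (rule emeasure_distr[OF Z sec])
    also have "Z -` (Pair (Y w) -` E) \<inter> space M = {w' \<in> space M. \<forall>i\<in>J. h i x w' \<in> A i}"
      using measurable_space[OF Y w] measurable_space[OF Z]
      by (auto simp: E_def A_def Y_def Z_def space_pair_measure)
    also have "prob {w' \<in> space M. \<forall>i\<in>J. h i x w' \<in> A i} = (\<Prod>i\<in>J. prob {w' \<in> space M. H w' \<in> A i})"
    proof (cases "J = {}")
      case False
      have single: "prob (h i x -` A i \<inter> space M) = prob {w' \<in> space M. H w' \<in> A i}" for i
        using arg_cong[OF distr_h[of i x], of "\<lambda>D. measure D (A i)"]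
        by (simp add: measure_distr vimage_def Int_def conj_commute)
      have "prob (\<Inter>p\<in>(\<lambda>i. (i, x)) ` J. h (fst p) (snd p) -` A (fst p) \<inter> space M) =
          (\<Prod>p\<in>(\<lambda>i. (i, x)) ` J. prob (h (fst p) (snd p) -` A (fst p) \<inter> space M))"
        using False \<open>finite J\<close> by (intro indep_varsD[OF indep_fading]) auto
      also have "(\<Inter>p\<in>(\<lambda>i. (i, x)) ` J. h (fst p) (snd p) -` A (fst p) \<inter> space M) =
          {w' \<in> space M. \<forall>i\<in>J. h i x w' \<in> A i}"
        using False by auto
      finally show ?thesis
        by (simp add: prod.reindex inj_on_def single)
    qed (simp add: prob_space)
    then have "emeasure M {w' \<in> space M. \<forall>i\<in>J. h i x w' \<in> A i} =
        (\<Prod>i\<in>J. emeasure M {w' \<in> space M. H w' \<in> A i})"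
      by (simp add: emeasure_eq_measure prod_ennreal)
    finally show ?thesis
      by (simp add: A_def)
  qed
  have "{w \<in> space M. \<forall>i\<in>J. (y i w, h i x w) \<in> Q} = (\<lambda>w. (Y w, Z w)) -` E \<inter> space M"
    using measurable_space[OF Y] measurable_space[OF Z]
    by (auto simp: E_def Y_def Z_def space_pair_measure)
  then have "emeasure M {w \<in> space M. \<forall>i\<in>J. (y i w, h i x w) \<in> Q} =
      emeasure (distr M P Y \<Otimes>\<^sub>M distr M F Z) E"
    unfolding joint[symmetric] using E by (simp add: emeasure_distr)
  also have "\<dots> = (\<integral>\<^sup>+ u. emeasure (distr M F Z) (Pair u -` E) \<partial>distr M P Y)"
    using E by (intro Z.emeasure_pair_measure_alt) (simp cong: sets_pair_measure_cong)
  also have "\<dots> = (\<integral>\<^sup>+ w. emeasure (distr M F Z) (Pair (Y w) -` E) \<partial>M)"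
    using E by (intro nn_integral_distr Y Z.measurable_emeasure_Pair)
      (simp cong: sets_pair_measure_cong)
  also have "\<dots> = (\<integral>\<^sup>+ w. (\<Prod>i\<in>J. emeasure M {w' \<in> space M. (y i w, H w') \<in> Q}) \<partial>M)"
    by (intro nn_integral_cong inner)
  finally show ?thesis .
qed

end

section \<open>The probability that no station reaches the user\<close>

text \<open>
  The point of rank 0 is the minimum, also when the minimum is attained several times.
\<close>

lemma increasing_point_0:
  assumes "m \<in> S" "\<And>u. u \<in> S \<Longrightarrow> m \<le> u"
  shows "increasing_point S 0 = m"
  unfolding increasing_point_def
proof (rule the_equality)
  have none: "{u \<in> S. u < m} = {}"
    using assms(2) by force
  show "m \<in> S \<and> finite {u \<in> S. u < m} \<and> card {u \<in> S. u < m} = 0"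
    unfolding none using assms(1) by simp
  show "t = m" if "t \<in> S \<and> finite {u \<in> S. u < t} \<and> card {u \<in> S. u < t} = 0" for t
    using that assms(1) assms(2)[of t] by (auto simp: not_less intro: antisym)
qed

lemma locally_finite_attains_min:
  fixes s :: "nat \<Rightarrow> real"
  assumes "\<And>n :: nat. finite {i. s i \<le> real n}"
  obtains i where "\<And>j. s i \<le> s j"
proof -
  obtain n :: nat where n: "s 0 \<le> real n"
    using real_arch_simple by blast
  let ?I = "{i. s i \<le> real n}"
  obtain i where i: "i \<in> ?I" "\<And>j. j \<in> ?I \<Longrightarrow> s i \<le> s j"
    using ex_min_if_finite[of "s ` ?I"] assms[of n] n by (force simp: not_less)
  show ?thesis
  proof (rule that)
    show "s i \<le> s j" for j
      using i by (cases "s j \<le> real n") auto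
  qed
qed

context fading_network
begin

text \<open>
  The probability that a base station at \<^term>\<open>z\<close> gives a user at \<^term>\<open>x\<close> a path loss fading of
  at most \<^term>\<open>\<beta>\<close>.
\<close>

definition reach :: "plane \<Rightarrow> real \<Rightarrow> plane \<Rightarrow> real" where
  "reach x \<beta> z = ccdf M H (inverse (L (z - x) * \<beta>))"

lemma ccdf_measurable [measurable]: "ccdf M H \<in> borel_measurable borel"
proof -
  have "mono (\<lambda>t. - ccdf M H t)"
    unfolding ccdf_def by (intro monoI) (auto intro!: finite_measure_mono)
  then have "(\<lambda>t. - (- ccdf M H t)) \<in> borel_measurable borel"
    by (intro borel_measurable_uminus borel_measurable_mono)
  then show ?thesis by simp
qed

lemma reach_measurable [measurable]: "reach x \<beta> \<in> borel_measurable borel"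
  unfolding reach_def[abs_def] by measurable

lemma reach_bounds: "0 \<le> reach x \<beta> z \<and> reach x \<beta> z \<le> 1"
  by (simp add: reach_def ccdf_def)

lemma
  shows prod_reach_nonneg: "0 \<le> (\<Prod>i<k. 1 - reach x \<beta> (u i))"
    and prod_reach_le_1: "(\<Prod>i<k. 1 - reach x \<beta> (u i)) \<le> 1"
  using reach_bounds by (auto intro!: prod_nonneg prod_le_1)

lemma nn_integral_reach: "(\<integral>\<^sup>+ z. ennreal (reach x \<beta> z) \<partial>lborel) = B_ext M H L \<beta>"
proof -
  have "B_ext M H L \<beta> = (\<integral>\<^sup>+ z. ennreal (reach x \<beta> z) \<partial>distr lborel borel ((+) x))"
    unfolding B_ext_def by (subst nn_integral_distr) (auto simp: reach_def)
  then show ?thesis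
    by (simp add: lborel_distr_plus)
qed

lemma
  assumes "0 < \<beta>"
  shows integrable_reach: "integrable lborel (reach x \<beta>)"
    and integral_reach: "integral\<^sup>L lborel (reach x \<beta>) = B_fun M H L \<beta>"
proof -
  show "integrable lborel (reach x \<beta>)"
    using B_finite[OF assms] reach_bounds
    by (intro integrableI_nonneg) (auto simp: nn_integral_reach)
  show "integral\<^sup>L lborel (reach x \<beta>) = B_fun M H L \<beta>"
    using reach_bounds
    by (subst integral_eq_nn_integral) (auto simp: nn_integral_reach B_fun_def)
qed

lemma null_event_density:
  assumes "A \<in> null_sets lborel"
  shows "emeasure M {w \<in> space M. H w \<in> A} = 0"
proof -
  have "emeasure M (H -` A \<inter> space M) = (\<integral>\<^sup>+ t. ennreal (pH t) * indicator A t \<partial>lborel)"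
    using assms by (intro distributed_emeasure[OF H_density]) auto
  also have "\<dots> = 0"
    using AE_not_in[OF assms] by (subst nn_integral_0_iff_AE)
      (use assms distributed_borel_measurable[OF H_density] in \<open>auto intro!: borel_measurable_indicator\<close>)
  finally show ?thesis
    by (simp add: vimage_def Int_def conj_commute)
qed

lemma AE_H_pos: "AE w in M. 0 < H w"
proof -
  have "AE w in M. H w \<noteq> 0"
    using null_event_density[of "{0}"] countable_imp_null_set_lborel[of "{0 :: real}"]
    by (subst AE_iff_measurable[OF _ refl]) auto
  with H_nonneg show "AE w in M. 0 < H w"
    by eventually_elim simp
qed

lemma AE_fading_pos: "AE w in M. \<forall>i. 0 < h i x w"
proof -
  have "AE t in distr M borel H. 0 < t"
    using AE_H_pos by (simp add: AE_distr_iff)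
  then have "AE t in distr M borel (h i x). 0 < t" for i
    unfolding distr_h .
  then have "AE w in M. 0 < h i x w" for i
    by (simp add: AE_distr_iff)
  then show ?thesis
    by (simp add: AE_all_countable)
qed

abbreviation fade :: "plane \<Rightarrow> nat \<Rightarrow> 'w \<Rightarrow> real" where
  "fade x i w \<equiv> path_loss_fading y h L x i w"

lemma fade_measurable [measurable]: "fade x i \<in> borel_measurable M"
  unfolding path_loss_fading_def[abs_def] by measurable

lemma fade_le_iff:
  assumes "0 < \<beta>" "0 < h i x w"
  shows "fade x i w \<le> \<beta> \<longleftrightarrow> inverse (L (y i w - x) * \<beta>) \<le> h i x w"
  using assms L_pos[of "y i w - x"] by (simp add: path_loss_fading_def field_simps)

text \<open>
  Each of the first \<^term>\<open>k\<close> stations fails to reach the user with conditional probability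
  \<^term>\<open>1 - reach x \<beta> z\<close>.
\<close>

lemma prob_no_server_among:
  assumes "0 < \<beta>"
  shows "prob {w \<in> space M. \<forall>i<k. h i x w < inverse (L (y i w - x) * \<beta>)} =
    expectation (\<lambda>w. \<Prod>i<k. 1 - reach x \<beta> (y i w))"
proof -
  define Q where "Q = {zt \<in> space (borel \<Otimes>\<^sub>M borel). snd zt < inverse (L (fst zt - x) * \<beta>)}"
  have Q: "Q \<in> sets (borel \<Otimes>\<^sub>M borel)"
    unfolding Q_def by measurable
  have miss: "emeasure M {w' \<in> space M. (y i w, H w') \<in> Q} = ennreal (1 - reach x \<beta> (y i w))" for i w
  proof -
    have "{w' \<in> space M. (y i w, H w') \<in> Q} =
        space M - {w' \<in> space M. inverse (L (y i w - x) * \<beta>) \<le> H w'}"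
      by (auto simp: Q_def space_pair_measure)
    then show ?thesis
      by (simp add: emeasure_eq_measure prob_compl reach_def ccdf_def)
  qed
  have "ennreal (prob {w \<in> space M. \<forall>i<k. h i x w < inverse (L (y i w - x) * \<beta>)}) =
      emeasure M {w \<in> space M. \<forall>i\<in>{..<k}. (y i w, h i x w) \<in> Q}"
    by (simp add: emeasure_eq_measure[symmetric] Q_def space_pair_measure lessThan_def)
  also have "\<dots> = (\<integral>\<^sup>+ w. (\<Prod>i<k. ennreal (1 - reach x \<beta> (y i w))) \<partial>M)"
    by (simp add: emeasure_marked_points[OF _ Q] miss)
  also have "\<dots> = (\<integral>\<^sup>+ w. ennreal (\<Prod>i<k. 1 - reach x \<beta> (y i w)) \<partial>M)"
    using reach_bounds by (intro nn_integral_cong prod_ennreal) auto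
  also have "\<dots> = ennreal (expectation (\<lambda>w. \<Prod>i<k. 1 - reach x \<beta> (y i w)))"
    by (intro nn_integral_eq_integral integrable_const_bound[where B=1] AE_I2)
      (simp_all add: abs_of_nonneg prod_reach_nonneg prod_reach_le_1)
  finally show ?thesis
    using reach_bounds by (simp add: prod_nonneg integral_nonneg)
qed

lemma prob_server:
  "prob {w \<in> space M. inverse (L (y i w - x) * \<beta>) \<le> h i x w} = expectation (\<lambda>w. reach x \<beta> (y i w))"
proof -
  define Q where "Q = {zt \<in> space (borel \<Otimes>\<^sub>M borel). inverse (L (fst zt - x) * \<beta>) \<le> snd zt}"
  have Q: "Q \<in> sets (borel \<Otimes>\<^sub>M borel)"
    unfolding Q_def by measurable
  have "ennreal (prob {w \<in> space M. inverse (L (y i w - x) * \<beta>) \<le> h i x w}) =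
      emeasure M {w \<in> space M. \<forall>i\<in>{i}. (y i w, h i x w) \<in> Q}"
    by (simp add: emeasure_eq_measure[symmetric] Q_def space_pair_measure)
  also have "\<dots> = (\<integral>\<^sup>+ w. ennreal (reach x \<beta> (y i w)) \<partial>M)"
    by (subst emeasure_marked_points[OF _ Q])
      (simp_all add: Q_def space_pair_measure emeasure_eq_measure reach_def ccdf_def)
  also have "\<dots> = ennreal (expectation (\<lambda>w. reach x \<beta> (y i w)))"
    using reach_bounds
    by (intro nn_integral_eq_integral integrable_const_bound[where B=1]) auto
  finally show ?thesis
    using reach_bounds by (simp add: integral_nonneg)
qed

text \<open>
  The bound on the expected number of stations that reach the user makes the probabilities
  summable.
\<close>

lemma AE_finite_fade_le:
  assumes "0 < \<beta>"
  shows "AE w in M. finite {i. fade x i w \<le> \<beta>}"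
proof -
  define A where "A i = {w \<in> space M. inverse (L (y i w - x) * \<beta>) \<le> h i x w}" for i
  have A[measurable]: "A i \<in> sets M" for i
    unfolding A_def by measurable
  have "summable (\<lambda>i. prob (A i))"
    unfolding A_def prob_server
    using reach_bounds sum_expectation_le[OF reach_measurable reach_bounds integrable_reach[OF assms]]
    by (intro summableI_nonneg_bounded) (auto intro!: integral_nonneg)
  then have "AE w in M. eventually (\<lambda>i. w \<in> space M - A i) sequentially"
    by (intro borel_cantelli_AE1) (auto simp: emeasure_eq_measure)
  with AE_fading_pos[of x] show ?thesis
  proof eventually_elim
    fix w assume pos: "\<forall>i. 0 < h i x w" and "eventually (\<lambda>i. w \<in> space M - A i) sequentially"
    then obtain k where "\<And>i. k \<le> i \<Longrightarrow> w \<in> space M \<and> w \<notin> A i"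
      by (auto simp: eventually_sequentially)
    then have "{i. fade x i w \<le> \<beta>} \<subseteq> {..<k}"
      using fade_le_iff[OF assms pos[rule_format]] by (auto simp: A_def not_le[symmetric])
    then show "finite {i. fade x i w \<le> \<beta>}"
      by (rule finite_subset) simp
  qed
qed

text \<open>
  Let the number of stations in \<open>prob_no_server_among\<close> tend to infinity and apply the
  generating functional.
\<close>

theorem prob_no_server:
  assumes "0 < \<beta>"
  shows "prob {w \<in> space M. \<forall>i. \<beta> < fade x i w} = exp (- (lam * B_fun M H L \<beta>))"
proof -
  define E where "E k = {w \<in> space M. \<forall>i<k. h i x w < inverse (L (y i w - x) * \<beta>)}" for k
  have [measurable]: "E k \<in> sets M" for k
    unfolding E_def by measurable
  have "(\<lambda>k. prob (E k)) \<longlonglongrightarrow> prob (\<Inter>k. E k)"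
    by (intro finite_Lim_measure_decseq decseq_SucI) (auto simp: E_def)
  moreover have "(\<lambda>k. prob (E k)) \<longlonglongrightarrow> expectation (\<lambda>w. void_product (\<lambda>i. reach x \<beta> (y i w)))"
    unfolding E_def prob_no_server_among[OF assms]
  proof (rule integral_dominated_convergence[where w="\<lambda>_. 1"])
    show "AE w in M. (\<lambda>k. \<Prod>i<k. 1 - reach x \<beta> (y i w)) \<longlonglongrightarrow> void_product (\<lambda>i. reach x \<beta> (y i w))"
      by (intro AE_I2 tendsto_void_product reach_bounds)
    show "AE w in M. norm (\<Prod>i<k. 1 - reach x \<beta> (y i w)) \<le> 1" for k
      by (intro AE_I2) (simp add: abs_of_nonneg prod_reach_nonneg prod_reach_le_1)
  qed auto
  ultimately have "prob (\<Inter>k. E k) = exp (- (lam * B_fun M H L \<beta>))"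
    using expectation_void_product[OF reach_measurable reach_bounds integrable_reach[OF assms]]
      LIMSEQ_unique by (metis integral_reach[OF assms])
  moreover have "prob {w \<in> space M. \<forall>i. \<beta> < fade x i w} = prob (\<Inter>k. E k)"
  proof (rule finite_measure_eq_AE)
    have "(\<Inter>k. E k) = {w \<in> space M. \<forall>i. h i x w < inverse (L (y i w - x) * \<beta>)}"
      by (auto simp: E_def)
    then show "AE w in M. w \<in> {w \<in> space M. \<forall>i. \<beta> < fade x i w} \<longleftrightarrow> w \<in> (\<Inter>k. E k)"
      using AE_fading_pos[of x]
      by (auto simp: not_le[symmetric] fade_le_iff[OF assms] simp del: inverse_mult_distrib
        elim!: eventually_mono)
  qed measurable
  ultimately show ?thesis by simp
qed

end

section \<open>The law of the smallest path loss fading\<close>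

text \<open>
  Away from 0 the preimage of \<^term>\<open>N\<close> is its image under the differentiable inverse map, and
  such maps preserve null sets.
\<close>

lemma null_sets_inverse_preimage:
  fixes N :: "real set"
  assumes N: "N \<in> null_sets lborel" and c: "0 < c"
  shows "{t. inverse (t * c) \<in> N} \<in> null_sets lborel"
proof -
  have "negligible N"
    using null_sets_completionI[OF N] by (simp add: negligible_iff_null_sets)
  then have "negligible (N - {0})"
    by (rule negligible_subset) auto
  moreover have "(\<lambda>s. inverse (c * s)) differentiable_on (N - {0})"
    using c by (auto simp: differentiable_on_def intro!: derivative_intros)
  ultimately have "negligible ((\<lambda>s. inverse (c * s)) ` (N - {0}))"
    by (intro negligible_differentiable_image_negligible) auto
  then have "negligible (insert 0 ((\<lambda>s. inverse (c * s)) ` (N - {0})))"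
    by simp
  moreover have "{t. inverse (t * c) \<in> N} \<subseteq> insert 0 ((\<lambda>s. inverse (c * s)) ` (N - {0}))"
  proof
    fix t assume t: "t \<in> {t. inverse (t * c) \<in> N}"
    show "t \<in> insert 0 ((\<lambda>s. inverse (c * s)) ` (N - {0}))"
    proof (cases "t = 0")
      case False
      then have "t = inverse (c * inverse (t * c))" "inverse (t * c) \<in> N - {0}"
        using c t by (auto simp: field_simps)
      then show ?thesis by blast
    qed simp
  qed
  ultimately have "negligible {t. inverse (t * c) \<in> N}"
    by (rule negligible_subset)
  moreover have [measurable]: "N \<in> sets borel"
    using N by auto
  have "{t. inverse (t * c) \<in> N} \<in> sets lborel"
    by simp
  ultimately show ?thesis
    by (simp only: negligible_iff_null_sets null_sets_completion_iff)
qed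

context fading_network
begin

text \<open>
  A version of the smallest path loss fading that is measurable on the whole space and not only up
  to a null set. The truncation at 0 keeps the infimum bounded below where a fading variable is
  negative.
\<close>

definition best_fading :: "plane \<Rightarrow> 'w \<Rightarrow> real" where
  "best_fading x w = (INF i. max 0 (fade x i w))"

lemma best_measurable [measurable]: "best_fading x \<in> borel_measurable M"
  unfolding best_fading_def[abs_def] by measurable

lemma AE_best:
  "AE w in M. ordered_path_loss_fading y h L x 0 w = best_fading x w \<and> 0 < best_fading x w \<and>
    (\<exists>i. best_fading x w = fade x i w) \<and> (\<forall>i. best_fading x w \<le> fade x i w)"
proof -
  have "AE w in M. finite {i. fade x i w \<le> real n}" for n :: nat
  proof -
    have "AE w in M. finite {i. fade x i w \<le> real n + 1}"
      by (rule AE_finite_fade_le) simp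
    then show ?thesis
      by eventually_elim (rule finite_subset[rotated], auto)
  qed
  then have "AE w in M. \<forall>n :: nat. finite {i. fade x i w \<le> real n}"
    unfolding AE_all_countable by blast
  with AE_fading_pos[of x] show ?thesis
  proof eventually_elim
    fix w assume pos: "\<forall>i. 0 < h i x w" and fin: "\<forall>n :: nat. finite {i. fade x i w \<le> real n}"
    obtain i where i: "\<And>j. fade x i w \<le> fade x j w"
      using locally_finite_attains_min[of "\<lambda>i. fade x i w"] fin by blast
    have fade_pos: "0 < fade x j w" for j
      using pos L_pos by (simp add: path_loss_fading_def)
    have "best_fading x w = (INF j. fade x j w)"
      unfolding best_fading_def using fade_pos by (intro INF_cong) (auto simp: max_def less_imp_le)
    also have "\<dots> = fade x i w"
      using i by (intro cInf_eq_minimum) auto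
    finally have "best_fading x w = fade x i w" .
    moreover have "ordered_path_loss_fading y h L x 0 w = fade x i w"
      unfolding ordered_path_loss_fading_def using i by (intro increasing_point_0) auto
    ultimately show "ordered_path_loss_fading y h L x 0 w = best_fading x w \<and> 0 < best_fading x w \<and>
        (\<exists>i. best_fading x w = fade x i w) \<and> (\<forall>i. best_fading x w \<le> fade x i w)"
      using fade_pos i by auto
  qed
qed

lemma prob_best_le:
  "prob {w \<in> space M. best_fading x w \<le> \<beta>} = (if 0 < \<beta> then 1 - exp (- (lam * B_fun M H L \<beta>)) else 0)"
proof (cases "0 < \<beta>")
  case True
  have "prob {w \<in> space M. \<not> best_fading x w \<le> \<beta>} = prob {w \<in> space M. \<forall>i. \<beta> < fade x i w}"
  proof (rule finite_measure_eq_AE)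
    show "AE w in M. w \<in> {w \<in> space M. \<not> best_fading x w \<le> \<beta>} \<longleftrightarrow> w \<in> {w \<in> space M. \<forall>i. \<beta> < fade x i w}"
      using AE_best[of x] by eventually_elim (auto simp: not_le dest: less_le_trans)
  qed measurable
  with prob_no_server[OF True] prob_neg[of "\<lambda>w. best_fading x w \<le> \<beta>"] True show ?thesis
    by simp
next
  case False
  have "AE w in M. \<not> best_fading x w \<le> \<beta>"
    using AE_best[of x] by eventually_elim (use False in auto)
  with False show ?thesis
    by (simp add: prob_eq_0)
qed

text \<open>
  The smallest path loss fading is one of countably many variables, and each of these avoids a
  null set almost surely because, for a fixed position of the station, it is a smooth function of
  a fading variable with a density.
\<close>

lemma best_absolutely_continuous: "absolutely_continuous lborel (distr M borel (best_fading x))"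
  unfolding absolutely_continuous_def
proof
  fix N :: "real set" assume N: "N \<in> null_sets lborel"
  then have [measurable]: "N \<in> sets borel" by auto
  have single: "AE w in M. fade x i w \<notin> N" for i
  proof -
    define Q where "Q = {zt \<in> space (borel \<Otimes>\<^sub>M borel). inverse (snd zt * L (fst zt - x)) \<in> N}"
    have Q: "Q \<in> sets (borel \<Otimes>\<^sub>M borel)"
      unfolding Q_def by measurable
    have "emeasure M {w' \<in> space M. (z, H w') \<in> Q} = 0" for z
      using null_event_density[OF null_sets_inverse_preimage[OF N L_pos[of "z - x"]]]
      by (simp add: Q_def space_pair_measure)
    then have "emeasure M {w \<in> space M. \<forall>i\<in>{i}. (y i w, h i x w) \<in> Q} = 0"
      by (subst emeasure_marked_points[OF _ Q]) simp_all
    then show ?thesis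
      by (subst AE_iff_measurable[OF _ refl])
        (auto simp: Q_def space_pair_measure path_loss_fading_def)
  qed
  then have "AE w in M. \<forall>i. fade x i w \<notin> N"
    unfolding AE_all_countable by blast
  with AE_best[of x] have "AE w in M. best_fading x w \<notin> N"
    by eventually_elim metis
  then show "N \<in> null_sets (distr M borel (best_fading x))"
    by (subst null_sets_distr_iff) (auto simp: AE_iff_null_sets vimage_def Int_def conj_commute)
qed

text \<open>
  The law has some density \<^term>\<open>q\<close>, and almost everywhere \<^term>\<open>q\<close> is the derivative of the
  distribution function \<open>G = 1 - exp (- \<lambda> B)\<close>. Since \<open>B = - ln (1 - G) / \<lambda>\<close>, the function \<open>B\<close>
  is differentiable wherever \<open>G\<close> is, and the chain rule expresses \<^term>\<open>q\<close> through \<open>B'\<close>.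
\<close>

theorem density_best:
  obtains q where "q \<in> borel_measurable borel" "\<And>t. 0 \<le> q t"
    "distributed M lborel (best_fading x) (\<lambda>t. ennreal (q t))"
    "AE t in lborel. 0 < t \<longrightarrow>
      q t = lam * (deriv (B_fun M H L) t * exp (- (lam * B_fun M H L t)))"
proof -
  define D where "D = distr M borel (best_fading x)"
  interpret D: prob_space D
    unfolding D_def by (rule prob_space_distr) measurable
  have ac: "absolutely_continuous lborel D" and sets: "sets D = sets lborel"
    unfolding D_def using best_absolutely_continuous by simp_all
  obtain q where q: "q \<in> borel_measurable lborel"
      "AE t in lborel. RN_deriv lborel D t = ennreal (q t)" "\<And>t. 0 \<le> q t"
    using sigma_finite_measure.real_RN_deriv[OF sigma_finite_lborel D.finite_measure_axioms ac sets] by metis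
  have [measurable]: "q \<in> borel_measurable borel"
    using q(1) by simp
  have D_eq: "D = density lborel (\<lambda>t. ennreal (q t))"
    using sigma_finite_measure.density_RN_deriv[OF sigma_finite_lborel ac sets] q(2) density_cong[of "RN_deriv lborel D" lborel "\<lambda>t. ennreal (q t)"]
    by simp
  have distr: "distributed M lborel (best_fading x) (\<lambda>t. ennreal (q t))"
    unfolding distributed_def D_eq[symmetric] by (auto simp: D_def cong: distr_cong)
  have "(\<integral>\<^sup>+ t. ennreal (q t) \<partial>lborel) = 1"
    using D.emeasure_space_1 unfolding D_eq by (simp add: emeasure_density)
  then have int: "integrable lborel q"
    using q(3) by (intro integrableI_nonneg) auto
  define G where "G t = measure D {..t}" for t
  have G_density: "G t = (LINT s:{..t}|lborel. q s)" for t
    unfolding G_def D_eq set_lebesgue_integral_def measure_def using q(3)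
    by (subst integral_eq_nn_integral)
      (auto simp: emeasure_density intro!: arg_cong[where f=enn2real] nn_integral_cong split: split_indicator)
  have G_eq: "G t = (if 0 < t then 1 - exp (- (lam * B_fun M H L t)) else 0)" for t
    using prob_best_le[of x t]
    by (simp add: G_def D_def measure_distr vimage_def Int_def conj_commute)
  have "q t = lam * (deriv (B_fun M H L) t * exp (- (lam * B_fun M H L t)))"
    if "0 < t" and d: "(G has_real_derivative q t) (at t)" for t
  proof -
    have "0 < 1 - G t"
      using \<open>0 < t\<close> by (simp add: G_eq)
    then have "((\<lambda>t. - ln (1 - G t) / lam) has_real_derivative q t / (1 - G t) / lam) (at t)"
      using lam_pos by (auto intro!: derivative_eq_intros d)
    then have "(B_fun M H L has_real_derivative q t / (1 - G t) / lam) (at t)"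
    proof (rule DERIV_cong_ev[THEN iffD1, OF refl _ refl, rotated])
      show "eventually (\<lambda>t. - ln (1 - G t) / lam = B_fun M H L t) (nhds t)"
        using eventually_nhds_in_open[of "{0<..}" t] \<open>0 < t\<close> lam_pos
        by (auto elim!: eventually_mono simp: G_eq)
    qed
    then show ?thesis
      using \<open>0 < t\<close> lam_pos by (simp add: DERIV_imp_deriv G_eq)
  qed
  with AE_cdf_has_derivative_density[OF int G_density]
  have "AE t in lborel. 0 < t \<longrightarrow> q t = lam * (deriv (B_fun M H L) t * exp (- (lam * B_fun M H L t)))"
    by auto
  with q(3) distr show ?thesis
    by (intro that[of q]) auto
qed

text \<open>
  A capacity function is only controlled on the positive half-line; it is extended by 0.
\<close>

lemma capacity_extend_measurable:
  assumes "capacity_function f"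
  shows "(\<lambda>t. indicator {0<..} t * f t) \<in> borel_measurable borel"
  using assms unfolding capacity_function_def
  by (subst (asm) borel_measurable_restrict_space_iff) auto

lemma nn_integral_first_point:
  "(\<integral>\<^sup>+ w. ennreal (f (ordered_path_loss_fading y h L x 0 w)) \<partial>M) =
    (\<integral>\<^sup>+ w. ennreal (indicator {0<..} (best_fading x w) * f (best_fading x w)) \<partial>M)"
  using AE_best[of x] by (intro nn_integral_cong_AE) (auto elim: eventually_mono)

theorem average_capacity:
  assumes f: "capacity_function f"
  shows "(\<integral>\<^sup>+ w. ennreal (f (ordered_path_loss_fading y h L x 0 w)) \<partial>M) =
    ennreal lam * (\<integral>\<^sup>+ \<beta>\<in>{0<..}. ennreal (deriv (B_fun M H L) \<beta> *
      exp (- (lam * B_fun M H L \<beta>)) * f \<beta>) \<partial>lborel)"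
proof -
  note [measurable] = capacity_extend_measurable[OF f]
  obtain q where [measurable]: "q \<in> borel_measurable borel" and q0: "\<And>t. 0 \<le> q t"
    and distr: "distributed M lborel (best_fading x) (\<lambda>t. ennreal (q t))"
    and q: "AE t in lborel. 0 < t \<longrightarrow>
      q t = lam * (deriv (B_fun M H L) t * exp (- (lam * B_fun M H L t)))"
    using density_best by blast
  have q': "AE t in lborel. 0 < t \<longrightarrow>
      deriv (B_fun M H L) t * exp (- (lam * B_fun M H L t)) = q t / lam"
    using q by eventually_elim (use lam_pos in auto)
  have "(\<integral>\<^sup>+ w. ennreal (f (ordered_path_loss_fading y h L x 0 w)) \<partial>M) =
      (\<integral>\<^sup>+ t. ennreal (q t) * ennreal (indicator {0<..} t * f t) \<partial>lborel)"
    unfolding nn_integral_first_point by (intro distributed_nn_integral[symmetric] distr) simp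
  also have "\<dots> = (\<integral>\<^sup>+ t. ennreal lam * ennreal (q t / lam * (indicator {0<..} t * f t)) \<partial>lborel)"
    using lam_pos q0 by (intro nn_integral_cong) (simp add: ennreal_mult'[symmetric])
  also have "\<dots> = ennreal lam * (\<integral>\<^sup>+ t. ennreal (q t / lam * (indicator {0<..} t * f t)) \<partial>lborel)"
    by (intro nn_integral_cmult) measurable
  also have "(\<integral>\<^sup>+ t. ennreal (q t / lam * (indicator {0<..} t * f t)) \<partial>lborel) =
      (\<integral>\<^sup>+ \<beta>\<in>{0<..}. ennreal (deriv (B_fun M H L) \<beta> * exp (- (lam * B_fun M H L \<beta>)) * f \<beta>) \<partial>lborel)"
    using q' by (intro nn_integral_cong_AE) (auto elim!: eventually_mono split: split_indicator)
  finally show ?thesis .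
qed

end



section \<open>The path loss exponent model\<close>

lemma powr_le_iff_le_root:
  fixes r a p :: real
  assumes "0 \<le> r" "0 \<le> a" "0 < p"
  shows "r powr p \<le> a \<longleftrightarrow> r \<le> a powr (1 / p)"
proof
  assume "r powr p \<le> a"
  then have "(r powr p) powr (1 / p) \<le> a powr (1 / p)"
    using assms by (intro powr_mono2) auto
  then show "r \<le> a powr (1 / p)"
    using assms by (simp add: powr_powr)
next
  assume "r \<le> a powr (1 / p)"
  then have "r powr p \<le> (a powr (1 / p)) powr p"
    using assms by (intro powr_mono2) auto
  then show "r powr p \<le> a"
    using assms by (simp add: powr_powr)
qed

context fading_network
begin

text \<open>
  Tonelli: \<open>B(\<beta>)\<close> is the mean area of the region in which a station with fading \<^term>\<open>H\<close>
  reaches a user at the origin.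
\<close>

lemma B_ext_eq_expected_area:
  "B_ext M H L \<beta> = (\<integral>\<^sup>+ w. emeasure lborel {z. inverse (L z * \<beta>) \<le> H w} \<partial>M)"
proof -
  interpret pair_sigma_finite "lborel :: plane measure" M
    by unfold_locales
  define I :: "plane \<Rightarrow> 'w \<Rightarrow> ennreal" where "I z w = indicator {zw. inverse (L (fst zw) * \<beta>) \<le> H (snd zw)} (z, w)" for z w
  have [measurable]: "(\<lambda>(z, w). I z w :: ennreal) \<in> borel_measurable (lborel \<Otimes>\<^sub>M M)"
    unfolding I_def by measurable
  have "B_ext M H L \<beta> = (\<integral>\<^sup>+ z. \<integral>\<^sup>+ w. I z w \<partial>M \<partial>lborel)"
    unfolding B_ext_def
  proof (rule nn_integral_cong)
    fix z
    have "(\<integral>\<^sup>+ w. I z w \<partial>M) = (\<integral>\<^sup>+ w. indicator {w \<in> space M. inverse (L z * \<beta>) \<le> H w} w \<partial>M)"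
      by (intro nn_integral_cong) (auto simp: I_def split: split_indicator)
    then show "ennreal (ccdf M H (inverse (L z * \<beta>))) = (\<integral>\<^sup>+ w. I z w \<partial>M)"
      by (simp add: ccdf_def emeasure_eq_measure del: inverse_mult_distrib)
  qed
  also have "\<dots> = (\<integral>\<^sup>+ w. \<integral>\<^sup>+ z. I z w \<partial>lborel \<partial>M)"
    by (intro Fubini'[symmetric]) measurable
  also have "\<dots> = (\<integral>\<^sup>+ w. emeasure lborel {z. inverse (L z * \<beta>) \<le> H w} \<partial>M)"
  proof (rule nn_integral_cong)
    fix w
    have [measurable]: "{z. inverse (L z * \<beta>) \<le> H w} \<in> sets borel"
      by measurable
    have "(\<integral>\<^sup>+ z. I z w \<partial>lborel) = (\<integral>\<^sup>+ z. indicator {z. inverse (L z * \<beta>) \<le> H w} z \<partial>lborel)"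
      by (intro nn_integral_cong) (auto simp: I_def split: split_indicator)
    then show "(\<integral>\<^sup>+ z. I z w \<partial>lborel) = emeasure lborel {z. inverse (L z * \<beta>) \<le> H w}"
      by simp
  qed
  finally show ?thesis .
qed

text \<open>
  For a given fading value \<open>H > 0\<close> the region in \<open>B_ext_eq_expected_area\<close> is, up to the origin,
  the disc of radius \<open>(K \<beta> H)\<^bsup>1/\<gamma>\<^esup>\<close>.
\<close>

lemma B_fun_path_loss_exponent:
  assumes K: "0 < K" and g: "0 < \<gamma>" and model: "path_loss_exponent_model K \<gamma> L" and b: "0 < \<beta>"
  shows "B_fun M H L \<beta> =
    pi * K powr (2 / \<gamma>) * (LINT w|M. H w powr (2 / \<gamma>)) * \<beta> powr (2 / \<gamma>)"
proof -
  have area: "emeasure lborel {z. inverse (L z * \<beta>) \<le> H w} =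
      ennreal (pi * K powr (2 / \<gamma>) * \<beta> powr (2 / \<gamma>)) * ennreal (H w powr (2 / \<gamma>))"
    if H: "0 < H w" for w
  proof -
    define a where "a = K * \<beta> * H w"
    have a: "0 < a"
      using K b H by (simp add: a_def)
    have disc: "inverse (L z * \<beta>) \<le> H w \<longleftrightarrow> z \<in> cball 0 (a powr (1 / \<gamma>))" if "z \<noteq> 0" for z
    proof -
      have "inverse (L z * \<beta>) = norm z powr \<gamma> / (K * \<beta>)"
        using model that by (simp add: path_loss_exponent_model_def powr_minus divide_inverse mult_ac)
      then have "inverse (L z * \<beta>) \<le> H w \<longleftrightarrow> norm z powr \<gamma> \<le> a"
        using K b by (simp add: a_def pos_divide_le_eq mult_ac)
      then show ?thesis
        using a g by (simp add: powr_le_iff_le_root)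
    qed
    have "AE z in lborel. z \<noteq> (0 :: plane)"
      by (rule AE_lborel_singleton)
    then have "AE z in lborel. z \<in> {z. inverse (L z * \<beta>) \<le> H w} \<longleftrightarrow> z \<in> cball 0 (a powr (1 / \<gamma>))"
      by eventually_elim (use disc in blast)
    then have "emeasure lborel {z. inverse (L z * \<beta>) \<le> H w} = emeasure lborel (cball (0 :: plane) (a powr (1 / \<gamma>)))"
      by (rule emeasure_eq_AE) measurable
    also have "\<dots> = ennreal (pi * (a powr (1 / \<gamma>))\<^sup>2)"
      by (simp add: emeasure_cball unit_ball_vol_2)
    also have "(a powr (1 / \<gamma>))\<^sup>2 = a powr (2 / \<gamma>)"
      by (simp add: power2_eq_square powr_add[symmetric])
    also have "a powr (2 / \<gamma>) = K powr (2 / \<gamma>) * \<beta> powr (2 / \<gamma>) * H w powr (2 / \<gamma>)"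
      using K b H by (simp add: a_def powr_mult)
    finally show ?thesis
      using K b by (simp add: ennreal_mult'[symmetric] mult_ac)
  qed
  have "B_ext M H L \<beta> = (\<integral>\<^sup>+ w. ennreal (pi * K powr (2 / \<gamma>) * \<beta> powr (2 / \<gamma>)) * ennreal (H w powr (2 / \<gamma>)) \<partial>M)"
    unfolding B_ext_eq_expected_area
    by (rule nn_integral_cong_AE) (use AE_H_pos in eventually_elim, rule area)
  also have "\<dots> = ennreal (pi * K powr (2 / \<gamma>) * \<beta> powr (2 / \<gamma>)) * (\<integral>\<^sup>+ w. ennreal (H w powr (2 / \<gamma>)) \<partial>M)"
    by (intro nn_integral_cmult) measurable
  finally show ?thesis
    by (simp add: B_fun_def enn2real_mult integral_eq_nn_integral mult_ac)
qed

text \<open>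
  The time change \<open>T = \<xi>\<^sub>0\<^bsup>2/\<gamma>\<^esup>\<close> turns \<open>exp (- \<lambda> C \<beta>\<^bsup>2/\<gamma>\<^esup>)\<close> into an exponential tail.
\<close>

theorem average_capacity_path_loss_exponent:
  assumes f: "capacity_function f"
    and K: "0 < K" and g: "0 < \<gamma>" and model: "path_loss_exponent_model K \<gamma> L"
  defines "C \<equiv> pi * K powr (2 / \<gamma>) * (LINT w|M. H w powr (2 / \<gamma>))"
  shows "(\<integral>\<^sup>+ w. ennreal (f (ordered_path_loss_fading y h L x 0 w)) \<partial>M) =
    ennreal (lam * C) * laplace_transform (\<lambda>t. f (t powr (\<gamma> / 2))) (lam * C)"
proof -
  note [measurable] = capacity_extend_measurable[OF f]
  define f' where "f' t = indicator {0<..} t * f t" for t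
  have [measurable]: "f' \<in> borel_measurable borel"
    unfolding f'_def[abs_def] by measurable
  have B: "B_fun M H L \<beta> = C * \<beta> powr (2 / \<gamma>)" if "0 < \<beta>" for \<beta>
    unfolding C_def using B_fun_path_loss_exponent[OF K g model that] .
  have "0 < B_fun M H L 1"
    using B_finite[of 1] by (simp add: B_fun_def enn2real_positive_iff)
  then have C: "0 < lam * C"
    using B[of 1] lam_pos by simp
  define T where "T w = best_fading x w powr (2 / \<gamma>)" for w
  have T_measurable [measurable]: "T \<in> borel_measurable M"
    unfolding T_def[abs_def] by measurable
  have distr: "distributed M lborel T (exponential_density (lam * C))"
  proof (rule exponential_distributedI[OF T_measurable C])
    fix a :: real assume "0 \<le> a"
    have "prob {w \<in> space M. T w \<le> a} = prob {w \<in> space M. best_fading x w \<le> a powr (\<gamma> / 2)}"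
    proof (rule finite_measure_eq_AE)
      show "AE w in M. w \<in> {w \<in> space M. T w \<le> a} \<longleftrightarrow> w \<in> {w \<in> space M. best_fading x w \<le> a powr (\<gamma> / 2)}"
        using AE_best[of x]
        by eventually_elim (use \<open>0 \<le> a\<close> g in \<open>auto simp: T_def powr_le_iff_le_root\<close>)
    qed measurable
    also have "\<dots> = 1 - exp (- a * (lam * C))"
      using \<open>0 \<le> a\<close> g by (auto simp: prob_best_le B powr_powr less_le mult_ac)
    finally show "emeasure M {w \<in> space M. T w \<le> a} = 1 - ennreal (exp (- a * (lam * C)))"
      by (simp add: emeasure_eq_measure ennreal_minus ennreal_1[symmetric] del: ennreal_1)
  qed
  have "(\<integral>\<^sup>+ w. ennreal (f (ordered_path_loss_fading y h L x 0 w)) \<partial>M) = (\<integral>\<^sup>+ w. ennreal (f' (T w powr (\<gamma> / 2))) \<partial>M)"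
    unfolding nn_integral_first_point f'_def[symmetric]
  proof (rule nn_integral_cong_AE)
    show "AE w in M. ennreal (f' (best_fading x w)) = ennreal (f' (T w powr (\<gamma> / 2)))"
      using AE_best[of x] by eventually_elim (use g in \<open>simp add: T_def powr_powr\<close>)
  qed
  also have "\<dots> = (\<integral>\<^sup>+ t. ennreal (exponential_density (lam * C) t) * ennreal (f' (t powr (\<gamma> / 2))) \<partial>lborel)"
    by (rule distributed_nn_integral[OF distr, symmetric]) measurable
  also have "\<dots> = (\<integral>\<^sup>+ t. ennreal (lam * C) *
      (ennreal (exp (- (lam * C * t)) * f' (t powr (\<gamma> / 2))) * indicator {0<..} t) \<partial>lborel)"
  proof (rule nn_integral_cong)
    fix t :: real
    let ?F = "f' (t powr (\<gamma> / 2))"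
    show "ennreal (exponential_density (lam * C) t) * ennreal ?F =
        ennreal (lam * C) * (ennreal (exp (- (lam * C * t)) * ?F) * indicator {0<..} t)"
    proof (cases "0 < t")
      case True
      then have "exponential_density (lam * C) t = lam * C * exp (- (lam * C * t))"
        by (simp add: exponential_density_def mult.commute)
      moreover have "ennreal (lam * C * exp (- (lam * C * t))) =
          ennreal (lam * C) * ennreal (exp (- (lam * C * t)))"
        using C by (intro ennreal_mult') simp
      moreover have "ennreal (exp (- (lam * C * t)) * ?F) = ennreal (exp (- (lam * C * t))) * ennreal ?F"
        by (intro ennreal_mult') simp
      ultimately show ?thesis
        using True by (simp add: mult.assoc)
    next
      case False
      then have "t = 0 \<or> exponential_density (lam * C) t = 0"
        by (auto simp: exponential_density_def)
      then show ?thesis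
        using False by (auto simp: f'_def)
    qed
  qed
  also have "\<dots> = ennreal (lam * C) * (\<integral>\<^sup>+ t\<in>{0<..}. ennreal (exp (- (lam * C * t)) * f' (t powr (\<gamma> / 2))) \<partial>lborel)"
    by (intro nn_integral_cmult) measurable
  also have "(\<integral>\<^sup>+ t\<in>{0<..}. ennreal (exp (- (lam * C * t)) * f' (t powr (\<gamma> / 2))) \<partial>lborel) =
      laplace_transform (\<lambda>t. f (t powr (\<gamma> / 2))) (lam * C)"
    unfolding laplace_transform_def
    by (intro nn_integral_cong) (auto simp: f'_def split: split_indicator)
  finally show ?thesis .
qed

end

section \<open>Average capacity per user\<close>

theorem theorem2:
  fixes M :: "'w measure"
    and lamB :: real
    and y :: "nat \<Rightarrow> 'w \<Rightarrow> plane"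
    and H :: "'w \<Rightarrow> real"
    and pH :: "real \<Rightarrow> real"
    and h :: "nat \<Rightarrow> plane \<Rightarrow> 'w \<Rightarrow> real"
    and L :: "plane \<Rightarrow> real"
    and f :: "real \<Rightarrow> real"
  assumes "prob_space M"
    and "0 < lamB"
    and "homogeneous_PPP M lamB y"
    and "path_loss_function L"
    and "AE w in M. 0 \<le> H w"
    and "\<And>t. 0 \<le> pH t"
    and "distributed M lborel H (\<lambda>t. ennreal (pH t))"
    and "\<And>\<beta>. 0 < ccdf M H \<beta>"
    and "independent_fading_marks M y H h"
    and "\<And>\<beta>. 0 < \<beta> \<Longrightarrow> 0 < B_ext M H L \<beta> \<and> B_ext M H L \<beta> < \<infinity>"
    and "capacity_function f"
  shows "(\<forall>x. (\<integral>\<^sup>+ w. ennreal (f (ordered_path_loss_fading y h L x 0 w)) \<partial>M) =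
            ennreal lamB * (\<integral>\<^sup>+ \<beta>\<in>{0<..}. ennreal (deriv (B_fun M H L) \<beta> *
               exp (- (lamB * B_fun M H L \<beta>)) * f \<beta>) \<partial>lborel)) \<and>
         (\<forall>K \<gamma> x. 0 < K \<and> 0 < \<gamma> \<and> path_loss_exponent_model K \<gamma> L \<longrightarrow>
            (let C = pi * K powr (2 / \<gamma>) * (LINT w|M. H w powr (2 / \<gamma>))
             in (\<integral>\<^sup>+ w. ennreal (f (ordered_path_loss_fading y h L x 0 w)) \<partial>M) =
                ennreal (lamB * C) *
                  laplace_transform (\<lambda>t. f (t powr (\<gamma> / 2))) (lamB * C)))"
proof -
  interpret fading_network M lamB y H pH h L
    by (intro fading_network.intro poisson_points.intro poisson_points_axioms.intro
      fading_network_axioms.intro) (fact assms)+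
  show ?thesis
    unfolding Let_def
    using average_capacity[OF assms(11)] average_capacity_path_loss_exponent[OF assms(11)]
    by blast
qed

end
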